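(* Let $X=\mathbb{R}^m$ with $d_X$ the Euclidean distance, and let $\alpha$ be a probability measure on $\mathbb{R}^m$ with full support having a smooth non-vanishing density function $f$ with respect to Lebesgue measure. Let $x_0\in\mathbb{R}^m$. For $\varepsilon>0$ set $\lambda=\lambda(\varepsilon)=\varepsilon^{-6}$ and $B_\varepsilon^{\lambda,\alpha}(x_0)=\{x\in\mathbb{R}^m: d^{(\varepsilon,\lambda)}_{\alpha,d_X}(x_0,x)\le\varepsilon\}$. Then the closure of $$\limsup_{\varepsilon\to0}\frac1\varepsilon B_\varepsilon^{\lambda,\alpha}(x_0)$$ is an ellipsoid in $\mathbb{R}^m$.
   Context: For $x\in\mathbb{R}^m$, $m^{(\varepsilon)}_{\alpha,d_X}(x)=\alpha|_{B_\varepsilon(x)}/\alpha(B_\varepsilon(x))$ is the renormalized restriction of $\alpha$ to the closed Euclidean ball $B_\varepsilon(x)$ of radius $\varepsilon$ centered at $x$, and $\Sigma^{(\varepsilon)}_{\alpha,d_X}(x)$ is the covariance matrix of this probability measure. For positive semi-definite matrices, $d_{\mathrm{cov}}(\Sigma_1,\Sigma_2)=\sqrt{\mathrm{tr}\big(\Sigma_1+\Sigma_2-2(\Sigma_1^{1/2}\Sigma_2\Sigma_1^{1/2})^{1/2}\big)}$. GT distance: $d^{(\varepsilon,\lambda)}_{\alpha,d_X}(x,x')=\left(\|x-x'\|^2+\lambda\, d_{\mathrm{cov}}^2\big(\Sigma^{(\varepsilon)}_{\alpha,d_X}(x),\Sigma^{(\varepsilon)}_{\alpha,d_X}(x')\big)\right)^{1/2}$.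 Rescaling about $x_0$: $\frac1\varepsilon B_\varepsilon^{\lambda,\alpha}(x_0)=\{x_0+\frac1\varepsilon(x-x_0): x\in B_\varepsilon^{\lambda,\alpha}(x_0)\}$. For a family of sets $(S_\varepsilon)_{\varepsilon>0}$, $\limsup_{\varepsilon\to0}S_\varepsilon=\bigcap_{\delta>0}\bigcup_{0<\varepsilon<\delta}S_\varepsilon$. An ellipsoid is a (solid) set $\{p+a: a\in\mathbb{R}^m,\ a^{\mathrm T}Qa\le1\}$ with $p\in\mathbb{R}^m$ and $Q$ a symmetric positive definite $m\times m$ matrix. *)

theory Defs
  imports "HOL-Probability.Probability"
begin

primrec C_k :: "nat \<Rightarrow> ('a::euclidean_space \<Rightarrow> real) \<Rightarrow> bool" where
  "C_k 0 f \<longleftrightarrow> continuous_on UNIV f"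
| "C_k (Suc k) f \<longleftrightarrow>
     (\<forall>x. f differentiable (at x)) \<and> (\<forall>v. C_k k (\<lambda>x. frechet_derivative f (at x) v))"

definition smooth :: "('a::euclidean_space \<Rightarrow> real) \<Rightarrow> bool" where
  "smooth f \<longleftrightarrow> (\<forall>k. C_k k f)"

definition measure_support :: "'a::topological_space measure \<Rightarrow> 'a set" where
  "measure_support \<mu> = {x. \<forall>U. open U \<and> x \<in> U \<longrightarrow> 0 < emeasure \<mu> U}"

definition mean :: "(real^'m) measure \<Rightarrow> real^'m" where
  "mean \<mu> = (LINT x|\<mu>. x)"

definition cov_matrix :: "(real^'m) measure \<Rightarrow> real^'m^'m" where
  "cov_matrix \<mu> = (\<chi> i j. LINT x|\<mu>. (x $ i - mean \<mu> $ i) * (x $ j - mean \<mu> $ j))"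

definition local_cov :: "(real^'m) measure \<Rightarrow> real \<Rightarrow> real^'m \<Rightarrow> real^'m^'m" where
  "local_cov \<alpha> \<epsilon> x = cov_matrix (uniform_measure \<alpha> (cball x \<epsilon>))"

text \<open>Despite its name, \<^const>\<open>uniform_measure\<close> \<open>\<alpha> A\<close> is the normalized
  restriction of the arbitrary measure \<open>\<alpha>\<close> to \<open>A\<close>, kept as a measure on the whole
  space.\<close>

definition pos_semidef :: "real^'m^'m \<Rightarrow> bool" where
  "pos_semidef A \<longleftrightarrow> transpose A = A \<and> (\<forall>v. 0 \<le> v \<bullet> (A *v v))"

definition pos_def :: "real^'m^'m \<Rightarrow> bool" where
  "pos_def A \<longleftrightarrow> transpose A = A \<and> (\<forall>v. v \<noteq> 0 \<longrightarrow> 0 < v \<bullet> (A *v v))"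

text \<open>The square root below is meaningful only for positive semi-definite arguments,
  where existence and uniqueness hold by the spectral theorem.\<close>

definition mat_sqrt :: "real^'m^'m \<Rightarrow> real^'m^'m" where
  "mat_sqrt A = (THE B. pos_semidef B \<and> B ** B = A)"

definition d_cov :: "real^'m^'m \<Rightarrow> real^'m^'m \<Rightarrow> real" where
  "d_cov A B =
     sqrt (trace (A + B - 2 *\<^sub>R mat_sqrt (mat_sqrt A ** B ** mat_sqrt A)))"

definition gt_dist :: "(real^'m) measure \<Rightarrow> real \<Rightarrow> real \<Rightarrow> real^'m \<Rightarrow> real^'m \<Rightarrow> real" where
  "gt_dist \<alpha> \<epsilon> l x x' =
     sqrt ((norm (x - x'))\<^sup>2 + l * (d_cov (local_cov \<alpha> \<epsilon> x) (local_cov \<alpha> \<epsilon> x'))\<^sup>2)"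

definition gt_ball :: "(real^'m) measure \<Rightarrow> real \<Rightarrow> real \<Rightarrow> real^'m \<Rightarrow> (real^'m) set" where
  "gt_ball \<alpha> \<epsilon> l x0 = {x. gt_dist \<alpha> \<epsilon> l x0 x \<le> \<epsilon>}"

definition rescale :: "real^'m \<Rightarrow> real \<Rightarrow> (real^'m) set \<Rightarrow> (real^'m) set" where
  "rescale x0 \<epsilon> S = (\<lambda>x. x0 + (1 / \<epsilon>) *\<^sub>R (x - x0)) ` S"

definition limsup_set :: "(real \<Rightarrow> 'a set) \<Rightarrow> 'a set" where
  "limsup_set S = (\<Inter>\<delta>\<in>{0<..}. \<Union>\<epsilon>\<in>{0<..<\<delta>}. S \<epsilon>)"

definition ellipsoid :: "(real^'m) set \<Rightarrow> bool" where
  "ellipsoid E \<longleftrightarrow> (\<exists>p Q. pos_def Q \<and> E = {p + a | a. a \<bullet> (Q *v a) \<le> 1})"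

end

theory Submission
  imports Defs
begin

text \<open>Fix \<open>y\<close> and put \<open>\<Sigma>\<^sub>\<epsilon>(y)\<close> for the local covariance at \<open>x0 + \<epsilon> y\<close>.  Expanding the density in a
  Taylor polynomial of degree 3 at \<open>x0\<close> and using the symmetries of the unit ball,
  \<open>\<Sigma>\<^sub>\<epsilon>(y) = \<epsilon>\<^sup>2 (r I + O(\<epsilon>\<^sup>2))\<close> with \<open>r > 0\<close>, and \<open>\<Sigma>\<^sub>\<epsilon>(y) - \<Sigma>\<^sub>\<epsilon>(0) = \<epsilon>\<^sup>5 (L y + o(1))\<close> with \<open>L\<close>
  linear.  Near a multiple \<open>s I\<close> of the identity, the squared covariance distance of \<open>A\<close> and \<open>B\<close> is
  asymptotic to \<open>\<parallel>B - A\<parallel>\<^sup>2 / (4 s)\<close> in the Frobenius norm; with \<open>s = r \<epsilon>\<^sup>2\<close> this is of order \<open>\<epsilon>\<^sup>8\<close>,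
  which is exactly balanced by the weight \<open>\<epsilon> powi (-6)\<close>.  So \<open>x0 + y\<close> lies in the rescaled ball iff
  \<open>q\<^sub>\<epsilon>(y) \<le> 1\<close>, where \<open>q\<^sub>\<epsilon>(y)\<close> converges to the positive definite quadratic form
  \<open>q(y) = \<parallel>y\<parallel>\<^sup>2 + \<parallel>L y\<parallel>\<^sup>2 / (4 r)\<close>.  Pointwise convergence suffices: the limit superior lies between
  \<open>{q < 1}\<close> and \<open>{q \<le> 1}\<close>, so its closure is \<open>{q \<le> 1}\<close>.\<close>

section \<open>The covariance distance near the identity\<close>

lemma norm_matrix_sq:
  fixes A :: "real^'n^'m"
  shows "(norm A)\<^sup>2 = (\<Sum>i\<in>UNIV. \<Sum>j\<in>UNIV. (A $ i $ j)\<^sup>2)"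
  unfolding power2_norm_eq_inner inner_vec_def by (simp add: power2_eq_square)

text \<open>The norm of \<open>real^'n^'m\<close> is the Frobenius norm, and each entry of the
  product is a row-column inner product, so Cauchy-Schwarz applies entry by entry.\<close>

lemma norm_matrix_mult_le:
  fixes A :: "real^'n^'m" and B :: "real^'p^'n"
  shows "norm (A ** B) \<le> norm A * norm B"
proof -
  have "(norm (A ** B))\<^sup>2 = (\<Sum>i\<in>UNIV. \<Sum>j\<in>UNIV. (row i A \<bullet> column j B)\<^sup>2)"
    by (simp add: norm_matrix_sq matrix_matrix_mult_def inner_vec_def row_def column_def)
  also have "\<dots> \<le> (\<Sum>i\<in>UNIV. \<Sum>j\<in>UNIV. (norm (row i A))\<^sup>2 * (norm (column j B))\<^sup>2)"
    by (intro sum_mono) (metis Cauchy_Schwarz_ineq power2_norm_eq_inner)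
  also have "\<dots> = (\<Sum>i\<in>UNIV. (norm (row i A))\<^sup>2) * (\<Sum>j\<in>UNIV. (norm (column j B))\<^sup>2)"
    by (simp add: sum_product)
  also have "(\<Sum>i\<in>UNIV. (norm (row i A))\<^sup>2) = (norm A)\<^sup>2"
    unfolding norm_matrix_sq power2_norm_eq_inner by (simp add: inner_vec_def row_def power2_eq_square)
  also have "(\<Sum>j\<in>UNIV. (norm (column j B))\<^sup>2) = (norm B)\<^sup>2"
    unfolding norm_matrix_sq power2_norm_eq_inner
    by (subst sum.swap) (simp add: inner_vec_def column_def power2_eq_square)
  finally show ?thesis
    by (metis power_mult_distrib power2_le_imp_le norm_ge_zero mult_nonneg_nonneg)
qed

lemma norm_matrix_vector_mult_le:
  fixes A :: "real^'n^'m"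
  shows "norm (A *v x) \<le> norm A * norm x"
proof -
  have "(norm (A *v x))\<^sup>2 = (\<Sum>i\<in>UNIV. (row i A \<bullet> x)\<^sup>2)"
    unfolding power2_norm_eq_inner
    by (simp add: inner_vec_def matrix_vector_mult_def row_def power2_eq_square)
  also have "\<dots> \<le> (\<Sum>i\<in>UNIV. (norm (row i A))\<^sup>2 * (norm x)\<^sup>2)"
    by (intro sum_mono) (metis Cauchy_Schwarz_ineq power2_norm_eq_inner)
  also have "\<dots> = (\<Sum>i\<in>UNIV. (norm (row i A))\<^sup>2) * (norm x)\<^sup>2"
    by (simp add: sum_distrib_right)
  also have "(\<Sum>i\<in>UNIV. (norm (row i A))\<^sup>2) = (norm A)\<^sup>2"
    unfolding norm_matrix_sq power2_norm_eq_inner by (simp add: inner_vec_def row_def power2_eq_square)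
  finally show ?thesis
    by (metis power_mult_distrib power2_le_imp_le norm_ge_zero mult_nonneg_nonneg)
qed

text \<open>Supplies the limit rules, the scalar and difference rules, and the null-times-bounded
  rules for matrix products.\<close>

interpretation matrix_mult: bounded_bilinear "(**) :: real^'n^'m \<Rightarrow> real^'p^'n \<Rightarrow> real^'p^'m"
proof
  show "\<exists>K. \<forall>(a::real^'n^'m) (b::real^'p^'n). norm (a ** b) \<le> norm a * norm b * K"
    by (intro exI[of _ 1]) (simp add: norm_matrix_mult_le)
qed (simp_all add: matrix_matrix_mult_def vec_eq_iff sum.distrib sum_distrib_left distrib_left
      distrib_right mult.left_commute mult.assoc)

lemma transpose_add: "transpose (A + B) = transpose A + transpose (B :: real^'n^'m)"
  by (simp add: transpose_def vec_eq_iff)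

lemma transpose_diff: "transpose (A - B) = transpose A - transpose (B :: real^'n^'m)"
  by (simp add: transpose_def vec_eq_iff)

lemma tendsto_transpose:
  fixes A :: "'b \<Rightarrow> real^'n^'m"
  assumes "(A \<longlongrightarrow> L) F"
  shows "((\<lambda>x. transpose (A x)) \<longlongrightarrow> transpose L) F"
  unfolding transpose_def using assms by (intro tendsto_vec_lambda tendsto_vec_nth)

lemma tendsto_trace:
  fixes A :: "'b \<Rightarrow> real^'n^'n"
  assumes "(A \<longlongrightarrow> L) F"
  shows "((\<lambda>x. trace (A x)) \<longlongrightarrow> trace L) F"
  unfolding trace_def using assms by (intro tendsto_sum tendsto_vec_nth)

lemma trace_scaleR: "trace (c *\<^sub>R A) = c * trace (A :: real^'n^'n)"
  by (simp add: trace_def sum_distrib_left)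

text \<open>Splits the trace into values of the quadratic form of \<open>B\<close> on the columns of
  \<open>D\<close>: semidefiniteness of \<open>B\<close> then gives a sign, and definiteness forces
  the columns to vanish when the trace does.\<close>

lemma trace_congruence:
  fixes D B :: "real^'n^'n"
  shows "trace (transpose D ** B ** D) = (\<Sum>i\<in>UNIV. column i D \<bullet> (B *v column i D))"
proof -
  have "(transpose D ** B ** D) $ i $ i = column i D \<bullet> (B *v column i D)" for i
    unfolding matrix_mul_assoc[symmetric]
    by (simp add: matrix_matrix_mult_def inner_vec_def column_def matrix_vector_mult_def transpose_def)
  then show ?thesis
    by (simp add: trace_def)
qed

lemma trace_mult_transpose: "trace (transpose A ** A) = (norm (A :: real^'n^'n))\<^sup>2"
  unfolding norm_matrix_sq
  by (subst sum.swap) (simp add: trace_def matrix_matrix_mult_def transpose_def power2_eq_square)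

section \<open>Definite matrices and square roots close to the identity\<close>

lemma pos_def_imp_pos_semidef: "pos_def A \<Longrightarrow> pos_semidef A"
  unfolding pos_def_def pos_semidef_def by (metis inner_zero_left less_eq_real_def)

text \<open>With \<open>D = B - C\<close> one has \<open>B D + D C = 0\<close>, so \<open>tr (D B D) + tr (D C D) = 0\<close> and
  both terms vanish; no commutation argument is needed when \<open>C\<close> is positive definite.\<close>

lemma mat_sqrt_eqI:
  fixes C :: "real^'n^'n"
  assumes C: "pos_def C" and A: "C ** C = A"
  shows "mat_sqrt A = C"
  unfolding mat_sqrt_def
proof (rule the_equality)
  show "pos_semidef C \<and> C ** C = A"
    using assms pos_def_imp_pos_semidef by blast
next
  fix B assume B: "pos_semidef B \<and> B ** B = A"
  define D where "D = B - C"
  have tD: "transpose D = D"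
    using B C by (simp add: D_def transpose_diff pos_semidef_def pos_def_def)
  \<comment> \<open>The mixed products \<open>B ** C\<close> cancel and leave
    \<open>B ** B - C ** C\<close>.\<close>
  have "B ** D + D ** C = 0"
    using A B by (simp add: D_def matrix_mult.diff_left matrix_mult.diff_right)
  then have "trace (D ** (B ** D + D ** C)) = 0"
    by (simp add: matrix_mult.zero_right trace_0[simplified])
  then have "trace (D ** B ** D) + trace (D ** (D ** C)) = 0"
    by (simp add: matrix_mult.add_right trace_add matrix_mul_assoc)
  moreover have "trace (D ** (D ** C)) = trace (D ** C ** D)"
    by (metis trace_mul_sym)
  moreover have "trace (D ** B ** D) \<ge> 0"
    using trace_congruence[of D B] B unfolding tD pos_semidef_def by (simp add: sum_nonneg)
  moreover have C0: "column i D \<bullet> (C *v column i D) \<ge> 0" for i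
    using pos_def_imp_pos_semidef[OF C] unfolding pos_semidef_def by blast
  ultimately have "trace (D ** C ** D) \<le> 0"
    by linarith
  then have "(\<Sum>i\<in>UNIV. column i D \<bullet> (C *v column i D)) = 0"
    using trace_congruence[of D C] C0 unfolding tD by (simp add: order_antisym sum_nonneg)
  then have "column i D \<bullet> (C *v column i D) = 0" for i
    using C0 by (simp add: sum_nonneg_eq_0_iff)
  then have "column i D = 0" for i
    using C unfolding pos_def_def by (metis less_irrefl)
  then have "D = 0"
    by (simp add: column_def vec_eq_iff)
  then show "B = C"
    by (simp add: D_def)
qed

text \<open>The Frobenius norm dominates the operator norm, so the form of \<open>P - mat 1\<close>
  is strictly smaller than \<open>v \<bullet> v\<close> in absolute value.\<close>

lemma pos_def_near_one:
  fixes P :: "real^'n^'n"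
  assumes "transpose P = P" "norm (P - mat 1) < 1"
  shows "pos_def P"
  unfolding pos_def_def
proof (intro conjI allI impI)
  fix v :: "real^'n" assume v: "v \<noteq> 0"
  have "\<bar>v \<bullet> ((P - mat 1) *v v)\<bar> \<le> norm v * (norm (P - mat 1) * norm v)"
    by (meson Cauchy_Schwarz_ineq2 mult_left_mono norm_ge_zero norm_matrix_vector_mult_le order_trans)
  also have "\<dots> < norm v * (1 * norm v)"
    using assms v by (intro mult_strict_left_mono mult_strict_right_mono) auto
  finally have "\<bar>v \<bullet> (P *v v) - v \<bullet> v\<bar> < v \<bullet> v"
    by (simp add: matrix_vector_mult_diff_rdistrib inner_diff_right norm_eq_sqrt_inner)
  then show "0 < v \<bullet> (P *v v)"
    by linarith
qed fact

lemma pos_def_scaleR: "pos_def A \<Longrightarrow> 0 < c \<Longrightarrow> pos_def (c *\<^sub>R A)"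
  by (simp add: pos_def_def transpose_scalar scaleR_matrix_vector_assoc[symmetric])

text \<open>The root is \<open>1 + Y\<close> where \<open>Y\<close> is the fixed point of the contraction
  \<open>Y \<mapsto> (X - Y\<^sup>2) / 2\<close>.\<close>

lemma sqrt_near_one:
  fixes A :: "real^'n^'n"
  assumes tA: "transpose A = A" and A: "norm (A - mat 1) \<le> 3/4"
  shows "\<exists>P. pos_def P \<and> P ** P = A \<and> norm (P - mat 1) \<le> norm (A - mat 1)"
proof -
  define X where "X = A - mat 1"
  \<comment> \<open>On radius \<open>1/2\<close> squaring has Lipschitz constant 1, so the halved
    map contracts by \<open>1/2\<close>. The bound \<open>3/4\<close> on \<open>X\<close> fits
    because \<open>(3/4 + 1/4) / 2 = 1/2\<close>, so \<open>f\<close> maps \<open>S\<close> into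
    itself.\<close>
  define S where "S = {Y :: real^'n^'n. transpose Y = Y \<and> norm Y \<le> 1/2}"
  define f where "f Y = (1/2) *\<^sub>R (X - Y ** Y)" for Y
  have YY: "norm (Y ** Y) \<le> (1/2) * norm Y" if "Y \<in> S" for Y
  proof -
    have "norm (Y ** Y) \<le> norm Y * norm Y"
      by (rule norm_matrix_mult_le)
    also have "\<dots> \<le> (1/2) * norm Y"
      using that by (intro mult_right_mono) (auto simp: S_def)
    finally show ?thesis .
  qed
  have "continuous_on UNIV (\<lambda>Y::real^'n^'n. transpose Y)"
    unfolding transpose_def by (intro continuous_intros)
  then have "closed S"
    unfolding S_def by (intro closed_Collect_conj closed_Collect_eq closed_Collect_le continuous_intros)
  then have "\<exists>!Y\<in>S. f Y = Y"
  proof (rule Banach_fix[OF complete_eq_closed[THEN iffD2]])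
    show "S \<noteq> {}"
      unfolding S_def by (auto intro!: exI[of _ 0] simp: transpose_def vec_eq_iff)
    show "f ` S \<subseteq> S"
    proof
      fix Z assume "Z \<in> f ` S"
      then obtain Y where Y: "Y \<in> S" "Z = f Y" by blast
      have "norm (X - Y ** Y) \<le> 3/4 + 1/4"
        using norm_triangle_ineq4[of X "Y ** Y"] YY[OF Y(1)] A Y(1) by (simp add: S_def X_def)
      then show "Z \<in> S"
        using Y tA by (simp add: S_def f_def transpose_scalar transpose_diff matrix_transpose_mul X_def)
    qed
    show "dist (f Y) (f Z) \<le> 1/2 * dist Y Z" if "Y \<in> S" "Z \<in> S" for Y Z
    proof -
      have "norm (Y ** Y - Z ** Z) = norm (Y ** (Y - Z) + (Y - Z) ** Z)"
        by (simp add: matrix_mult.diff_left matrix_mult.diff_right)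
      also have "\<dots> \<le> norm Y * norm (Y - Z) + norm (Y - Z) * norm Z"
        by (intro order_trans[OF norm_triangle_ineq] add_mono norm_matrix_mult_le)
      also have "\<dots> \<le> (1/2) * norm (Y - Z) + norm (Y - Z) * (1/2)"
        using that by (intro add_mono mult_right_mono mult_left_mono) (auto simp: S_def)
      finally have "norm (Y ** Y - Z ** Z) \<le> norm (Y - Z)" by simp
      moreover have "f Y - f Z = (1/2) *\<^sub>R (Z ** Z - Y ** Y)"
        by (simp add: f_def algebra_simps)
      ultimately show ?thesis
        by (simp add: dist_norm norm_minus_commute)
    qed
  qed auto
  then obtain Y where Y: "Y \<in> S" "f Y = Y" by blast
  \<comment> \<open>The fixed point equation, rearranged to say that the square of
    \<open>mat 1 + Y\<close> is \<open>mat 1 + X = A\<close>.\<close>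
  have eq: "Y + Y + Y ** Y = X"
    by (subst (1 2) Y(2)[symmetric]) (simp add: f_def scaleR_add_left[symmetric])
  define P where "P = mat 1 + Y"
  have "P ** P = A"
    using eq by (simp add: P_def X_def matrix_mult.add_left matrix_mult.add_right algebra_simps)
  moreover have "pos_def P"
    using Y(1) by (intro pos_def_near_one) (auto simp: P_def S_def transpose_add)
  moreover have "norm Y \<le> norm X"
  proof -
    have "2 * norm Y = norm (Y + Y)"
      by (simp add: scaleR_2[symmetric])
    also have "Y + Y = X - Y ** Y"
      using eq by (simp add: algebra_simps)
    also have "norm \<dots> \<le> norm X + (1/2) * norm Y"
      using norm_triangle_ineq4[of X "Y ** Y"] YY[OF Y(1)] by simp
    finally show ?thesis
      using norm_ge_zero[of Y] by linarith
  qed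
  ultimately show ?thesis
    by (intro exI[of _ P]) (auto simp: P_def X_def)
qed

text \<open>Uniqueness from \<open>mat_sqrt_eqI\<close> identifies the root built by contraction
  with the description in \<open>mat_sqrt\<close>.\<close>

lemma mat_sqrt_near_one:
  fixes A :: "real^'n^'n"
  assumes "transpose A = A" "norm (A - mat 1) \<le> 3/4"
  shows "pos_def (mat_sqrt A)" "mat_sqrt A ** mat_sqrt A = A"
    "norm (mat_sqrt A - mat 1) \<le> norm (A - mat 1)"
proof -
  obtain P where "pos_def P" "P ** P = A" "norm (P - mat 1) \<le> norm (A - mat 1)"
    using sqrt_near_one[OF assms] by blast
  with mat_sqrt_eqI[of P A] show "pos_def (mat_sqrt A)" "mat_sqrt A ** mat_sqrt A = A"
    "norm (mat_sqrt A - mat 1) \<le> norm (A - mat 1)"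
    by auto
qed

lemma eventually_near_one:
  fixes A :: "'b \<Rightarrow> real^'n^'n"
  assumes "(A \<longlongrightarrow> mat 1) F"
  shows "\<forall>\<^sub>F x in F. norm (A x - mat 1) \<le> 3/4"
  using tendstoD[OF assms, of "3/4"] by (auto elim!: eventually_mono simp: dist_norm)

lemma tendsto_mat_sqrt_one:
  fixes A :: "'b \<Rightarrow> real^'n^'n"
  assumes lim: "(A \<longlongrightarrow> mat 1) F" and sym: "\<forall>\<^sub>F x in F. transpose (A x) = A x"
  shows "((\<lambda>x. mat_sqrt (A x)) \<longlongrightarrow> mat 1) F"
    "\<forall>\<^sub>F x in F. pos_def (mat_sqrt (A x)) \<and> mat_sqrt (A x) ** mat_sqrt (A x) = A x"
proof -
  have *: "\<forall>\<^sub>F x in F. transpose (A x) = A x \<and> norm (A x - mat 1) \<le> 3/4"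
    using eventually_near_one[OF lim] sym by eventually_elim simp
  have "((\<lambda>x. mat_sqrt (A x) - mat 1) \<longlongrightarrow> 0) F"
  proof (rule Lim_null_comparison)
    show "\<forall>\<^sub>F x in F. norm (mat_sqrt (A x) - mat 1) \<le> norm (A x - mat 1)"
      using * by eventually_elim (simp add: mat_sqrt_near_one)
    show "((\<lambda>x. norm (A x - mat 1)) \<longlongrightarrow> 0) F"
      using lim LIM_zero tendsto_norm_zero by blast
  qed
  then show "((\<lambda>x. mat_sqrt (A x)) \<longlongrightarrow> mat 1) F"
    by (rule LIM_zero_cancel)
  show "\<forall>\<^sub>F x in F. pos_def (mat_sqrt (A x)) \<and> mat_sqrt (A x) ** mat_sqrt (A x) = A x"
    using * by eventually_elim (simp add: mat_sqrt_near_one)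
qed

section \<open>Inverses close to the identity\<close>

lemma pos_def_inverse:
  fixes A :: "real^'n^'n"
  assumes "pos_def A"
  shows "A ** matrix_inv A = mat 1" "matrix_inv A ** A = mat 1"
proof -
  have "x = 0" if "A *v x = 0" for x
    using assms that unfolding pos_def_def by (metis inner_zero_right less_irrefl)
  then have "invertible A"
    by (meson invertible_left_inverse matrix_left_invertible_ker)
  then show "A ** matrix_inv A = mat 1" "matrix_inv A ** A = mat 1"
    unfolding invertible_def matrix_inv_def by (metis (mono_tags, lifting) someI_ex)+
qed

lemma tendsto_matrix_inv_one:
  fixes A :: "'b \<Rightarrow> real^'n^'n"
  assumes lim: "(A \<longlongrightarrow> mat 1) F" and pd: "\<forall>\<^sub>F x in F. pos_def (A x)"
  shows "((\<lambda>x. matrix_inv (A x)) \<longlongrightarrow> mat 1) F"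
proof -
  \<comment> \<open>The Frobenius norm of the identity is the square root of the dimension, so it
    remains in the constant.\<close>
  let ?c = "2 * norm (mat 1 :: real^'n^'n)"
  have "\<forall>\<^sub>F x in F. norm (A x - mat 1) < 1/2"
    using tendstoD[OF lim, of "1/2"] by (simp add: dist_norm)
  with pd have "\<forall>\<^sub>F x in F. norm (matrix_inv (A x) - mat 1) \<le> ?c * norm (A x - mat 1)"
  proof eventually_elim
    case (elim x)
    let ?J = "matrix_inv (A x)"
    \<comment> \<open>This identity bounds \<open>?J - mat 1\<close> in terms of \<open>?J\<close>
      itself. Once \<open>A x\<close> is within \<open>1/2\<close> of the identity, half of
      \<open>norm ?J\<close> can be absorbed on the left, which bounds
      \<open>norm ?J\<close>.\<close>
    have eq: "?J - mat 1 = (mat 1 - A x) ** ?J"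
      using pos_def_inverse[OF elim(1)] by (simp add: matrix_mult.diff_left)
    have le: "norm (?J - mat 1) \<le> norm (A x - mat 1) * norm ?J"
      unfolding eq by (metis norm_matrix_mult_le norm_minus_commute)
    also have "\<dots> \<le> 1/2 * norm ?J"
      using elim by (intro mult_right_mono) auto
    finally have "norm ?J \<le> ?c"
      using norm_triangle_ineq2[of ?J "mat 1"] by linarith
    then have "norm (A x - mat 1) * norm ?J \<le> norm (A x - mat 1) * ?c"
      by (intro mult_left_mono) auto
    with le show ?case by (simp add: mult.commute)
  qed
  moreover have "((\<lambda>x. ?c * norm (A x - mat 1)) \<longlongrightarrow> 0) F"
    using lim by (intro tendsto_mult_right_zero tendsto_norm_zero LIM_zero)
  ultimately have "((\<lambda>x. matrix_inv (A x) - mat 1) \<longlongrightarrow> 0) F"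
    by (rule Lim_null_comparison)
  then show ?thesis
    by (rule LIM_zero_cancel)
qed

text \<open>An exact formula for the squared covariance distance: writing \<open>M = A + D\<close> for the
  root of \<open>P B P\<close>, the first-order terms in \<open>D\<close> and \<open>B - A\<close> cancel under the trace.\<close>

lemma trace_cov_eq:
  fixes A B P M J :: "real^'n^'n"
  assumes P: "P ** P = A" and M: "M ** M = P ** B ** P"
    and J: "J ** A = mat 1" "A ** J = mat 1"
  defines "D \<equiv> M - A"
  shows "A ** D + D ** A + D ** D = P ** (B - A) ** P"
    "trace (A + B - 2 *\<^sub>R M) = trace (D ** J ** D)"
proof -
  have M': "M = A + D" by (simp add: D_def)
  have AA: "P ** A ** P = A ** A"
    unfolding P[symmetric] by (simp add: matrix_mul_assoc)
  show eq: "A ** D + D ** A + D ** D = P ** (B - A) ** P"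
    using M unfolding M'
    by (simp add: matrix_mult.diff_left matrix_mult.diff_right matrix_mult.add_left
        matrix_mult.add_right AA algebra_simps)
  \<comment> \<open>So \<open>J ** P\<close> is the two-sided inverse of \<open>P\<close>, and by
    cyclicity of the trace the conjugation of \<open>B - A\<close> by \<open>P\<close> is undone
    after multiplication by \<open>J\<close>.\<close>
  have "(J ** P) ** P = mat 1"
    using J(1) P by (simp add: matrix_mul_assoc[symmetric])
  then have "P ** (J ** P) = mat 1"
    using matrix_left_right_inverse by blast
  then have "trace ((J ** P ** (B - A)) ** P) = trace (B - A)"
    by (subst trace_mul_sym) (simp add: matrix_mul_assoc)
  then have "trace (J ** (P ** (B - A) ** P)) = trace (B - A)"
    by (simp add: matrix_mul_assoc)
  moreover have "trace (J ** (A ** D + D ** A + D ** D)) =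
      trace (J ** A ** D) + trace (J ** D ** A) + trace (J ** D ** D)"
    by (simp add: matrix_mult.add_right trace_add matrix_mul_assoc)
  moreover have "trace (J ** D ** A) = trace D"
    by (subst trace_mul_sym) (simp add: matrix_mul_assoc J)
  moreover have "trace (J ** D ** D) = trace (D ** J ** D)"
    by (subst trace_mul_sym) (simp add: matrix_mul_assoc)
  \<comment> \<open>The first identity multiplied by \<open>J\<close> and traced. Since
    \<open>A + B - 2 *\<^sub>R M\<close> equals \<open>(B - A) - 2 *\<^sub>R D\<close>, only the
    quadratic term survives.\<close>
  ultimately have "trace (B - A) = 2 * trace D + trace (D ** J ** D)"
    using J eq by simp
  moreover have "A + B - 2 *\<^sub>R M = (B - A) - 2 *\<^sub>R D"
    by (simp add: M' algebra_simps scaleR_2)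
  ultimately show "trace (A + B - 2 *\<^sub>R M) = trace (D ** J ** D)"
    by (simp only: trace_sub trace_scaleR)
qed

text \<open>Scaling both arguments by \<open>s\<close> scales the inner root by
  \<open>sqrt s\<close> and the outer one by \<open>s\<close>. The absolute value appears because
  \<open>sqrt a * sqrt a\<close> is the absolute value of \<open>a\<close> for every real
  \<open>a\<close>.\<close>

lemma d_cov_scaleR:
  fixes A B P M :: "real^'n^'n"
  assumes P: "pos_def P" "P ** P = A" and M: "pos_def M" "M ** M = P ** B ** P" and s: "0 < s"
  shows "(d_cov (s *\<^sub>R A) (s *\<^sub>R B))\<^sup>2 = s * \<bar>trace (A + B - 2 *\<^sub>R M)\<bar>"
proof -
  have 1: "mat_sqrt (s *\<^sub>R A) = sqrt s *\<^sub>R P"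
    using P s by (intro mat_sqrt_eqI pos_def_scaleR)
      (auto simp: matrix_mult.scaleR_left matrix_mult.scaleR_right)
  have 2: "mat_sqrt ((sqrt s *\<^sub>R P) ** (s *\<^sub>R B) ** (sqrt s *\<^sub>R P)) = s *\<^sub>R M"
    using M s by (intro mat_sqrt_eqI pos_def_scaleR)
      (auto simp: matrix_mult.scaleR_left matrix_mult.scaleR_right)
  have "s *\<^sub>R A + s *\<^sub>R B - 2 *\<^sub>R s *\<^sub>R M = s *\<^sub>R (A + B - 2 *\<^sub>R M)"
    by (simp add: algebra_simps)
  then have "d_cov (s *\<^sub>R A) (s *\<^sub>R B) = sqrt (s * trace (A + B - 2 *\<^sub>R M))"
    unfolding d_cov_def 1 2 by (simp only: trace_scaleR)
  then show ?thesis
    using s by (simp only: power2_eq_square real_sqrt_mult_self abs_mult abs_of_pos)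
qed

text \<open>With \<open>D\<close> the deviation of the root \<open>M\<close> from \<open>A\<close>,
  dividing \<open>trace_cov_eq\<close> by \<open>t\<close> gives an almost linear equation for
  \<open>d = D / t\<close>. Its limit is \<open>2 *\<^sub>R d = \<Delta>\<close>, and the traced
  quadratic term then yields a quarter of the squared norm of \<open>\<Delta>\<close>.\<close>

theorem d_cov_asymptotics:
  fixes A B :: "'b \<Rightarrow> real^'n^'n" and s t :: "'b \<Rightarrow> real"
  assumes sym: "\<And>x. transpose (A x) = A x" "\<And>x. transpose (B x) = B x"
    and A: "(A \<longlongrightarrow> mat 1) F"
    and BA: "((\<lambda>x. (1 / t x) *\<^sub>R (B x - A x)) \<longlongrightarrow> \<Delta>) F"
    and t0: "(t \<longlongrightarrow> 0) F" and t: "\<forall>\<^sub>F x in F. 0 < t x" and s: "\<forall>\<^sub>F x in F. 0 < s x"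
  shows "((\<lambda>x. (d_cov (s x *\<^sub>R A x) (s x *\<^sub>R B x))\<^sup>2 / (s x * (t x)\<^sup>2)) \<longlongrightarrow> (norm \<Delta>)\<^sup>2 / 4) F"
proof (cases "F = bot")
  case False
  define e where "e x = (1 / t x) *\<^sub>R (B x - A x)" for x
  define P where "P x = mat_sqrt (A x)" for x
  define M where "M x = mat_sqrt (P x ** B x ** P x)" for x
  define D where "D x = M x - A x" for x
  define J where "J x = matrix_inv (A x)" for x
  define d where "d x = (1 / t x) *\<^sub>R D x" for x
  have e: "(e \<longlongrightarrow> \<Delta>) F"
    using BA unfolding e_def .
  have "transpose (e x) = e x" for x
    by (simp add: e_def transpose_scalar transpose_diff sym)
  with tendsto_transpose[OF e] have "(e \<longlongrightarrow> transpose \<Delta>) F"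
    by simp
  \<comment> \<open>Symmetry of the limit turns \<open>trace (\<Delta> ** \<Delta>)\<close> into the
    squared Frobenius norm at the end. Uniqueness of limits is where the filter must be
    nontrivial.\<close>
  then have sym\<Delta>: "transpose \<Delta> = \<Delta>"
    using e False tendsto_unique by blast
  have "((\<lambda>x. A x + t x *\<^sub>R e x) \<longlongrightarrow> mat 1 + 0 *\<^sub>R \<Delta>) F"
    by (intro tendsto_intros A t0 e)
  moreover have "\<forall>\<^sub>F x in F. A x + t x *\<^sub>R e x = B x"
    using t by eventually_elim (simp add: e_def)
  ultimately have B: "(B \<longlongrightarrow> mat 1) F"
    by (simp add: tendsto_cong)
  have P: "(P \<longlongrightarrow> mat 1) F" and P': "\<forall>\<^sub>F x in F. pos_def (P x) \<and> P x ** P x = A x"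
    using tendsto_mat_sqrt_one[OF A] sym unfolding P_def by auto
  have "((\<lambda>x. P x ** B x ** P x) \<longlongrightarrow> mat 1 ** mat 1 ** mat 1) F"
    by (intro matrix_mult.tendsto P B)
  moreover have "\<forall>\<^sub>F x in F. transpose (P x ** B x ** P x) = P x ** B x ** P x"
    using P' by eventually_elim (simp add: matrix_transpose_mul sym pos_def_def matrix_mul_assoc)
  ultimately have M: "(M \<longlongrightarrow> mat 1) F"
    and M': "\<forall>\<^sub>F x in F. pos_def (M x) \<and> M x ** M x = P x ** B x ** P x"
    using tendsto_mat_sqrt_one[of "\<lambda>x. P x ** B x ** P x" F] unfolding M_def by auto
  have D: "(D \<longlongrightarrow> 0) F"
    using tendsto_diff[OF M A] unfolding D_def by simp
  have A': "\<forall>\<^sub>F x in F. pos_def (A x)"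
    using eventually_near_one[OF A] by eventually_elim (intro pos_def_near_one, auto simp: sym)
  have J: "(J \<longlongrightarrow> mat 1) F"
    unfolding J_def by (rule tendsto_matrix_inv_one[OF A A'])
  have eqs: "\<forall>\<^sub>F x in F. A x ** d x + d x ** A x + D x ** d x = P x ** e x ** P x \<and>
      (d_cov (s x *\<^sub>R A x) (s x *\<^sub>R B x))\<^sup>2 / (s x * (t x)\<^sup>2) = \<bar>trace (d x ** J x ** d x)\<bar>"
    using P' M' A' t s
  proof eventually_elim
    case (elim x)
    note * = trace_cov_eq[of "P x" "A x" "M x" "B x" "J x", folded D_def]
    have 1: "A x ** D x + D x ** A x + D x ** D x = P x ** (B x - A x) ** P x"
      and 2: "trace (A x + B x - 2 *\<^sub>R M x) = trace (D x ** J x ** D x)"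
      using * elim pos_def_inverse[of "A x"] by (auto simp: J_def)
    have "A x ** d x + d x ** A x + D x ** d x = P x ** e x ** P x"
      using arg_cong[OF 1, of "(*\<^sub>R) (1 / t x)"]
      by (simp add: d_def e_def matrix_mult.scaleR_left matrix_mult.scaleR_right scaleR_add_right)
    moreover have "(d_cov (s x *\<^sub>R A x) (s x *\<^sub>R B x))\<^sup>2 = s x * \<bar>trace (D x ** J x ** D x)\<bar>"
      using d_cov_scaleR[of "P x" "A x" "M x" "B x" "s x"] elim 2 by simp
    moreover have "trace (d x ** J x ** d x) = trace (D x ** J x ** D x) / (t x)\<^sup>2"
      by (simp add: d_def matrix_mult.scaleR_left matrix_mult.scaleR_right trace_scaleR power2_eq_square)
    ultimately show ?case
      using elim by simp
  qed
  \<comment> \<open>The error in \<open>2 *\<^sub>R d = P ** e ** P\<close>. Each term is a product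
    of \<open>d\<close> with a null factor, so \<open>R\<close> tends to zero as soon as
    \<open>d\<close> is known to be bounded.\<close>
  define R where "R x = (A x - mat 1) ** d x + d x ** (A x - mat 1) + D x ** d x" for x
  have eqR: "\<forall>\<^sub>F x in F. 2 *\<^sub>R d x = P x ** e x ** P x - R x"
    using eqs by eventually_elim
      (auto simp: R_def matrix_mult.diff_left matrix_mult.diff_right scaleR_2 algebra_simps)
  have PeP: "((\<lambda>x. P x ** e x ** P x) \<longlongrightarrow> \<Delta>) F"
    using matrix_mult.tendsto[OF matrix_mult.tendsto[OF P e] P] by simp
  have A0: "((\<lambda>x. A x - mat 1) \<longlongrightarrow> 0) F"
    using A by (rule LIM_zero)
  have "((\<lambda>x. 2 * norm (A x - mat 1) + norm (D x)) \<longlongrightarrow> 2 * 0 + 0) F"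
    by (intro tendsto_intros tendsto_norm_zero A0 D)
  then have small: "\<forall>\<^sub>F x in F. 2 * norm (A x - mat 1) + norm (D x) < 1"
    by (auto dest: order_tendstoD(2)[where a = "1::real"])
  have "\<forall>\<^sub>F x in F. norm (P x ** e x ** P x) < norm \<Delta> + 1"
    using order_tendstoD(2)[OF tendsto_norm[OF PeP], of "norm \<Delta> + 1"] by simp
  \<comment> \<open>Absorption: \<open>norm (R x) \<le> norm (d x)\<close>, so one of the two copies
    of \<open>norm (d x)\<close> can be moved to the other side.\<close>
  with small eqR have "\<forall>\<^sub>F x in F. norm (d x) \<le> norm \<Delta> + 1"
  proof eventually_elim
    case (elim x)
    have "norm (R x) \<le> norm (A x - mat 1) * norm (d x) + norm (d x) * norm (A x - mat 1)
        + norm (D x) * norm (d x)"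
      unfolding R_def by (intro norm_triangle_mono norm_matrix_mult_le)
    also have "\<dots> = (2 * norm (A x - mat 1) + norm (D x)) * norm (d x)"
      by (simp add: algebra_simps)
    also have "\<dots> \<le> 1 * norm (d x)"
      using elim by (intro mult_right_mono) auto
    finally have "norm (R x) \<le> norm (d x)" by simp
    moreover have "2 * norm (d x) = norm (P x ** e x ** P x - R x)"
      using arg_cong[OF elim(2), of norm] by simp
    ultimately show ?case
      using norm_triangle_ineq4[of "P x ** e x ** P x" "R x"] elim by linarith
  qed
  then have Bd: "Bfun d F"
    by (rule BfunI)
  have "((\<lambda>x. R x) \<longlongrightarrow> 0) F"
    unfolding R_def using Bd A0 D unfolding tendsto_Zfun_iff diff_zero
    by (intro Zfun_add matrix_mult.Zfun_prod_Bfun matrix_mult.Bfun_prod_Zfun)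
  then have "((\<lambda>x. (1/2) *\<^sub>R (P x ** e x ** P x - R x)) \<longlongrightarrow> (1/2) *\<^sub>R (\<Delta> - 0)) F"
    by (intro tendsto_intros PeP)
  moreover have "\<forall>\<^sub>F x in F. (1/2) *\<^sub>R (P x ** e x ** P x - R x) = d x"
    using eqR by eventually_elim (metis scaleR_half_double scaleR_2)
  ultimately have d: "(d \<longlongrightarrow> (1/2) *\<^sub>R \<Delta>) F"
    by (simp add: tendsto_cong)
  have "((\<lambda>x. \<bar>trace (d x ** J x ** d x)\<bar>) \<longlongrightarrow>
      \<bar>trace ((1/2) *\<^sub>R \<Delta> ** mat 1 ** (1/2) *\<^sub>R \<Delta>)\<bar>) F"
    by (intro tendsto_rabs tendsto_trace matrix_mult.tendsto d J)
  also have "\<bar>trace ((1/2) *\<^sub>R \<Delta> ** mat 1 ** (1/2) *\<^sub>R \<Delta>)\<bar> = (norm \<Delta>)\<^sup>2 / 4"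
    using trace_mult_transpose[of \<Delta>] sym\<Delta>
    by (simp add: matrix_mult.scaleR_left matrix_mult.scaleR_right trace_scaleR)
  finally show ?thesis
    by (rule tendsto_cong[THEN iffD1, rotated])
      (use eqs in \<open>eventually_elim, simp\<close>)
qed simp

section \<open>Taylor expansion along directional derivatives\<close>

text \<open>The direction comes first, so that the \<open>k\<close>-th derivative along
  \<open>w\<close> is the iterate \<open>dir_deriv w ^^ k\<close>.\<close>

definition dir_deriv :: "'a \<Rightarrow> ('a::euclidean_space \<Rightarrow> real) \<Rightarrow> 'a \<Rightarrow> real" where
  "dir_deriv v f = (\<lambda>x. frechet_derivative f (at x) v)"

lemma smooth_dir_deriv: "smooth f \<Longrightarrow> smooth (dir_deriv v f)"
  unfolding smooth_def dir_deriv_def using C_k.simps(2) by blast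

lemma smooth_has_derivative:
  assumes "smooth f"
  shows "(f has_derivative (\<lambda>v. dir_deriv v f x)) (at x)"
proof -
  have "f differentiable (at x)"
    using assms unfolding smooth_def by (metis C_k.simps(2))
  then show ?thesis
    by (simp add: dir_deriv_def frechet_derivative_works[symmetric])
qed

lemma dir_deriv_eq: "(f has_derivative f') (at x) \<Longrightarrow> dir_deriv v f x = f' v"
  by (simp add: dir_deriv_def frechet_derivative_at[symmetric])

lemma smooth_continuous_on: "smooth f \<Longrightarrow> continuous_on S f"
  unfolding smooth_def using C_k.simps(1) continuous_on_subset by blast

lemma linear_dir_deriv: "smooth f \<Longrightarrow> linear (\<lambda>v. dir_deriv v f x)"
  using smooth_has_derivative has_derivative_linear by blast

section \<open>Finite linear combinations of smooth functions\<close>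

lemma has_derivative_smooth_sum:
  assumes "\<And>i. i \<in> S \<Longrightarrow> smooth (f i)"
  shows "((\<lambda>x. \<Sum>i\<in>S. c i * f i x) has_derivative (\<lambda>v. \<Sum>i\<in>S. c i * dir_deriv v (f i) x)) (at x)"
  using assms by (intro has_derivative_sum has_derivative_mult_right smooth_has_derivative)

lemma dir_deriv_sum:
  assumes "\<And>i. i \<in> S \<Longrightarrow> smooth (f i)"
  shows "dir_deriv v (\<lambda>x. \<Sum>i\<in>S. c i * f i x) = (\<lambda>x. \<Sum>i\<in>S. c i * dir_deriv v (f i) x)"
  using dir_deriv_eq[OF has_derivative_smooth_sum[OF assms]] by (intro ext)

text \<open>Smooth summands stay smooth under differentiation, so the induction hypothesis applies
  again to their directional derivatives.\<close>

lemma C_k_sum: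
  assumes "\<And>i. i \<in> S \<Longrightarrow> smooth (f i)"
  shows "C_k k (\<lambda>x. \<Sum>i\<in>S. c i * f i x)"
  using assms
proof (induction k arbitrary: f)
  case 0
  then show ?case
    by (simp add: continuous_on_sum continuous_on_mult_left smooth_continuous_on)
next
  case (Suc k)
  have "(\<lambda>x. \<Sum>i\<in>S. c i * f i x) differentiable at x" for x
    unfolding differentiable_def
    by (rule exI, rule has_derivative_smooth_sum, rule Suc.prems)
  moreover have "C_k k (dir_deriv v (\<lambda>x. \<Sum>i\<in>S. c i * f i x))" for v
    using Suc by (simp add: dir_deriv_sum smooth_dir_deriv)
  ultimately show ?case
    by (simp add: dir_deriv_def)
qed

lemma smooth_sum:
  assumes "\<And>i. i \<in> S \<Longrightarrow> smooth (f i)"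
  shows "smooth (\<lambda>x. \<Sum>i\<in>S. c i * f i x)"
  unfolding smooth_def by (intro allI C_k_sum) (rule assms)

lemma smooth_add: "smooth f \<Longrightarrow> smooth g \<Longrightarrow> smooth (\<lambda>x. f x + g x)"
  using smooth_sum[of UNIV "\<lambda>i. if i then f else g" "\<lambda>_. 1"] by (simp add: UNIV_bool add.commute)

text \<open>Reduces an arbitrary direction to finitely many fixed ones; bounds and continuity in
  \<open>w\<close> follow because \<open>w\<close> enters only through the coefficients.\<close>

lemma dir_deriv_basis:
  assumes "smooth f"
  shows "dir_deriv w f = (\<lambda>x. \<Sum>b\<in>Basis. (w \<bullet> b) * dir_deriv b f x)"
proof
  fix x
  interpret linear "\<lambda>v. dir_deriv v f x" by (rule linear_dir_deriv[OF assms])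
  have "dir_deriv w f x = dir_deriv (\<Sum>b\<in>Basis. (w \<bullet> b) *\<^sub>R b) f x"
    by (simp add: euclidean_representation)
  then show "dir_deriv w f x = (\<Sum>b\<in>Basis. (w \<bullet> b) * dir_deriv b f x)"
    by (simp add: sum scale)
qed

lemma smooth_iterated_dir_deriv: "smooth f \<Longrightarrow> smooth ((dir_deriv w ^^ n) f)"
  by (induction n) (auto intro: smooth_dir_deriv)

lemma iterated_dir_deriv_sum:
  assumes "\<And>i. i \<in> S \<Longrightarrow> smooth (f i)"
  shows "(dir_deriv w ^^ n) (\<lambda>x. \<Sum>i\<in>S. c i * f i x) =
    (\<lambda>x. \<Sum>i\<in>S. c i * (dir_deriv w ^^ n) (f i) x)"
  by (induction n) (simp_all add: dir_deriv_sum assms smooth_iterated_dir_deriv)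

text \<open>The bound is uniform in the direction as well as the point, which makes the Taylor
  remainder uniform over a ball of directions.\<close>

lemma iterated_dir_deriv_bounded:
  fixes f :: "'a::euclidean_space \<Rightarrow> real"
  assumes "smooth f" "compact S"
  shows "\<exists>K. \<forall>w x. norm w \<le> R \<longrightarrow> x \<in> S \<longrightarrow> \<bar>(dir_deriv w ^^ n) f x\<bar> \<le> K"
  using assms(1)
proof (induction n arbitrary: f)
  case 0
  have "bounded (f ` S)"
    using 0 assms(2) by (intro compact_imp_bounded compact_continuous_image smooth_continuous_on)
  then show ?case
    by (auto simp: bounded_iff)
next
  case (Suc n)
  have "\<exists>K. \<forall>w x. norm w \<le> R \<longrightarrow> x \<in> S \<longrightarrow> \<bar>(dir_deriv w ^^ n) (dir_deriv b f) x\<bar> \<le> K" for b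
    by (intro Suc.IH smooth_dir_deriv Suc.prems)
  then obtain K where K: "\<And>b w x. norm w \<le> R \<Longrightarrow> x \<in> S \<Longrightarrow> \<bar>(dir_deriv w ^^ n) (dir_deriv b f) x\<bar> \<le> K b"
    by metis
  have "\<bar>(dir_deriv w ^^ Suc n) f x\<bar> \<le> (\<Sum>b\<in>Basis. R * K b)" if "norm w \<le> R" "x \<in> S" for w x
  proof -
    have "(dir_deriv w ^^ Suc n) f x = (\<Sum>b\<in>Basis. (w \<bullet> b) * (dir_deriv w ^^ n) (dir_deriv b f) x)"
      \<comment> \<open>The innermost derivative is expanded in the basis, so that the induction
        hypothesis meets the smooth functions \<open>dir_deriv b f\<close>.\<close>
      unfolding funpow_Suc_right o_def
      by (subst dir_deriv_basis[OF Suc.prems], subst iterated_dir_deriv_sum)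
        (auto intro: smooth_dir_deriv Suc.prems)
    also have "\<bar>\<dots>\<bar> \<le> (\<Sum>b\<in>Basis. R * K b)"
    proof (rule order_trans[OF sum_abs], rule sum_mono)
      fix b :: 'a assume "b \<in> Basis"
      then have "\<bar>w \<bullet> b\<bar> \<le> R"
        using that Basis_le_norm order_trans by blast
      then show "\<bar>(w \<bullet> b) * (dir_deriv w ^^ n) (dir_deriv b f) x\<bar> \<le> R * K b"
        unfolding abs_mult using K[OF that, of b] by (intro mult_mono) auto
    qed
    finally show ?thesis .
  qed
  then show ?case by blast
qed

text \<open>One-variable Taylor with Lagrange remainder along the segment from \<open>x\<close> in
  direction \<open>w\<close>.\<close>

lemma smooth_taylor:
  fixes f :: "'a::euclidean_space \<Rightarrow> real"
  assumes "smooth f"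
  shows "\<exists>K. \<forall>w \<epsilon>. norm w \<le> R \<longrightarrow> 0 \<le> \<epsilon> \<longrightarrow> \<epsilon> \<le> 1 \<longrightarrow>
    \<bar>f (x + \<epsilon> *\<^sub>R w) - (\<Sum>k<n. \<epsilon> ^ k * ((dir_deriv w ^^ k) f x / fact k))\<bar> \<le> K * \<epsilon> ^ n"
proof -
  obtain K where K: "\<And>w y. norm w \<le> R \<Longrightarrow> y \<in> cball x R \<Longrightarrow> \<bar>(dir_deriv w ^^ n) f y\<bar> \<le> K"
    using iterated_dir_deriv_bounded[OF assms compact_cball] by metis
  have "\<bar>f (x + \<epsilon> *\<^sub>R w) - (\<Sum>k<n. \<epsilon> ^ k * ((dir_deriv w ^^ k) f x / fact k))\<bar> \<le> K * \<epsilon> ^ n"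
    if w: "norm w \<le> R" and \<epsilon>: "0 \<le> \<epsilon>" "\<epsilon> \<le> 1" for w \<epsilon>
  proof -
    define diff where "diff k t = (dir_deriv w ^^ k) f (x + t *\<^sub>R w)" for k t
    have "(diff m has_real_derivative diff (Suc m) t) (at t)" for m t
    proof -
      let ?g = "(dir_deriv w ^^ m) f"
      have g: "smooth ?g"
        by (rule smooth_iterated_dir_deriv[OF assms])
      have "((\<lambda>t. x + t *\<^sub>R w) has_derivative (\<lambda>h. h *\<^sub>R w)) (at t)"
        by (auto intro!: derivative_eq_intros)
      from has_derivative_compose[OF this smooth_has_derivative[OF g]]
      have "(diff m has_derivative (\<lambda>h. dir_deriv (h *\<^sub>R w) ?g (x + t *\<^sub>R w))) (at t)"
        by (simp add: diff_def[abs_def])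
      moreover have "dir_deriv (h *\<^sub>R w) ?g y = h * dir_deriv w ?g y" for h y
        using linear_scale[OF linear_dir_deriv[OF g]] by simp
      ultimately show ?thesis
        by (simp add: has_field_derivative_def diff_def mult_commute_abs)
    qed
    then obtain t where t: "\<bar>t\<bar> \<le> \<bar>\<epsilon>\<bar>"
      and eq: "diff 0 \<epsilon> = (\<Sum>m<n. (diff m 0 / fact m) * \<epsilon> ^ m) + (diff n t / fact n) * \<epsilon> ^ n"
      using Maclaurin_all_le[of diff "diff 0" \<epsilon> n] by blast
    \<comment> \<open>The intermediate point stays in \<open>cball x R\<close>, where the derivative
      bound was taken.\<close>
    have "norm (t *\<^sub>R w) \<le> 1 * R"
      unfolding norm_scaleR using t w \<epsilon> by (intro mult_mono) auto
    then have "\<bar>diff n t\<bar> \<le> K"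
      unfolding diff_def by (intro K w) (simp add: dist_norm)
    moreover have "\<bar>diff n t\<bar> / fact n \<le> \<bar>diff n t\<bar> / 1"
      by (intro divide_left_mono) (simp_all add: fact_ge_1)
    ultimately have "\<bar>(diff n t / fact n) * \<epsilon> ^ n\<bar> \<le> K * \<epsilon> ^ n"
      unfolding abs_mult abs_divide using \<epsilon> by (intro mult_mono) auto
    then show ?thesis
      using eq by (simp add: diff_def mult.commute)
  qed
  then show ?thesis by blast
qed

text \<open>Stated as equalities of functions so that they rewrite beneath an outer
  \<open>dir_deriv\<close>.\<close>

lemma smooth_multilinear:
  fixes f :: "'a::euclidean_space \<Rightarrow> real"
  assumes "smooth f"
  shows "dir_deriv (u + u') f = (\<lambda>x. dir_deriv u f x + dir_deriv u' f x)"
    and "dir_deriv (c *\<^sub>R u) f = (\<lambda>x. c * dir_deriv u f x)"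
    and "dir_deriv (- u) f = (\<lambda>x. - dir_deriv u f x)"
  using linear_add[OF linear_dir_deriv[OF assms]] linear_scale[OF linear_dir_deriv[OF assms]]
    linear_neg[OF linear_dir_deriv[OF assms]]
  by auto

lemma dir_deriv_add:
  assumes "smooth f" "smooth g"
  shows "dir_deriv v (\<lambda>x. f x + g x) = (\<lambda>x. dir_deriv v f x + dir_deriv v g x)"
  using assms by (intro ext dir_deriv_eq has_derivative_add smooth_has_derivative)

lemma dir_deriv_cmult:
  assumes "smooth f"
  shows "dir_deriv v (\<lambda>x. c * f x) = (\<lambda>x. c * dir_deriv v f x)"
  using assms by (intro ext dir_deriv_eq has_derivative_mult_right smooth_has_derivative)

lemma dir_deriv_minus:
  assumes "smooth f"
  shows "dir_deriv v (\<lambda>x. - f x) = (\<lambda>x. - dir_deriv v f x)"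
  using assms by (intro ext dir_deriv_eq has_derivative_minus smooth_has_derivative)

text \<open>The sum runs up to order \<open>n\<close> and the error has order \<open>n + 1\<close>,
  so division by the \<open>n\<close>-th power leaves an error of at most
  \<open>K * \<epsilon>\<close>.\<close>

lemma expansion_leading_term:
  fixes \<phi> :: "real \<Rightarrow> real"
  assumes bound: "\<And>\<epsilon>. 0 < \<epsilon> \<Longrightarrow> \<epsilon> \<le> 1 \<Longrightarrow> \<bar>\<phi> \<epsilon> - (\<Sum>k<Suc n. \<epsilon> ^ k * c k)\<bar> \<le> K * \<epsilon> ^ Suc n"
    and zero: "\<And>k. k < n \<Longrightarrow> c k = 0"
  shows "((\<lambda>\<epsilon>. \<phi> \<epsilon> / \<epsilon> ^ n) \<longlongrightarrow> c n) (at_right 0)"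
proof (rule LIM_zero_cancel, rule Lim_null_comparison)
  show "\<forall>\<^sub>F \<epsilon> in at_right 0. norm (\<phi> \<epsilon> / \<epsilon> ^ n - c n) \<le> K * \<epsilon>"
    using eventually_at_right_real[of 0 1, OF zero_less_one]
  proof eventually_elim
    case (elim \<epsilon>)
    then have "\<bar>\<phi> \<epsilon> - \<epsilon> ^ n * c n\<bar> \<le> K * \<epsilon> * \<epsilon> ^ n"
      using bound[of \<epsilon>] zero by (simp add: mult.assoc)
    moreover have "\<phi> \<epsilon> / \<epsilon> ^ n - c n = (\<phi> \<epsilon> - \<epsilon> ^ n * c n) / \<epsilon> ^ n"
      using elim by (simp add: field_simps)
    ultimately show ?case
      using elim by (simp add: abs_divide pos_divide_le_eq)
  qed
  show "((\<lambda>\<epsilon>. K * \<epsilon>) \<longlongrightarrow> 0) (at_right 0)"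
    by (auto intro!: tendsto_eq_intros)
qed

section \<open>Integrals over balls and local covariance\<close>

text \<open>Integrals over shrinking balls are all moved to this fixed ball, so that the radius
  enters only through the integrand.\<close>

definition ball_integral :: "('a::euclidean_space \<Rightarrow> real) \<Rightarrow> real" where
  "ball_integral h = (LINT z:cball 0 1|lborel. h z)"

lemma set_integrable_compact_lborel:
  fixes h :: "'a::euclidean_space \<Rightarrow> 'b::{banach, second_countable_topology}"
  assumes "compact S" "continuous_on S h"
  shows "set_integrable lborel S h"
  unfolding set_integrable_def using borel_integrable_compact[OF assms] .

lemma ball_integrable:
  fixes h :: "'a::euclidean_space \<Rightarrow> real"
  assumes "continuous_on UNIV h"
  shows "set_integrable lborel (cball 0 1) h"
  using assms by (intro set_integrable_compact_lborel) (auto intro: continuous_on_subset)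

lemma ball_integral_add:
  fixes g h :: "'a::euclidean_space \<Rightarrow> real"
  assumes "continuous_on UNIV g" "continuous_on UNIV h"
  shows "ball_integral (\<lambda>z. g z + h z) = ball_integral g + ball_integral h"
  unfolding ball_integral_def using assms by (intro set_integral_add ball_integrable)

lemma ball_integral_diff:
  fixes g h :: "'a::euclidean_space \<Rightarrow> real"
  assumes "continuous_on UNIV g" "continuous_on UNIV h"
  shows "ball_integral (\<lambda>z. g z - h z) = ball_integral g - ball_integral h"
  unfolding ball_integral_def using assms by (intro set_integral_diff ball_integrable)

lemma ball_integral_cmult: "ball_integral (\<lambda>z. c * h z) = c * ball_integral h"
  unfolding ball_integral_def by simp

lemma ball_integral_sum:
  fixes h :: "'i \<Rightarrow> 'a::euclidean_space \<Rightarrow> real"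
  assumes "finite I" "\<And>i. i \<in> I \<Longrightarrow> continuous_on UNIV (h i)"
  shows "ball_integral (\<lambda>z. \<Sum>i\<in>I. h i z) = (\<Sum>i\<in>I. ball_integral (h i))"
  using assms
proof (induction I)
  case empty
  then show ?case by (simp add: ball_integral_def set_lebesgue_integral_def)
next
  case (insert i I)
  then show ?case
    by (simp add: ball_integral_add continuous_on_sum)
qed

lemma ball_integral_mono:
  fixes g h :: "'a::euclidean_space \<Rightarrow> real"
  assumes "continuous_on UNIV g" "continuous_on UNIV h" "\<And>z. norm z \<le> 1 \<Longrightarrow> g z \<le> h z"
  shows "ball_integral g \<le> ball_integral h"
  unfolding ball_integral_def using assms by (intro set_integral_mono ball_integrable) auto

lemma ball_integral_bound:
  fixes h :: "'a::euclidean_space \<Rightarrow> real"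
  assumes "continuous_on UNIV h" "\<And>z. norm z \<le> 1 \<Longrightarrow> \<bar>h z\<bar> \<le> K"
  shows "\<bar>ball_integral h\<bar> \<le> K * ball_integral (\<lambda>_::'a. 1)"
proof -
  have "ball_integral h \<le> ball_integral (\<lambda>_::'a. K * 1)"
    using assms(2) by (intro ball_integral_mono assms(1) continuous_intros) force
  moreover have "ball_integral (\<lambda>_::'a. - K * 1) \<le> ball_integral h"
    using assms(2) by (intro ball_integral_mono assms(1) continuous_intros) force
  ultimately show ?thesis
    unfolding ball_integral_cmult by linarith
qed

text \<open>By continuity \<open>h\<close> exceeds \<open>h w / 2\<close> on a small ball around
  \<open>w\<close> inside the unit ball.\<close>

lemma ball_integral_pos:
  fixes h :: "'a::euclidean_space \<Rightarrow> real"
  assumes h: "continuous_on UNIV h" "\<And>z. 0 \<le> h z" and w: "norm w < 1" "0 < h w"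
  shows "0 < ball_integral h"
proof -
  have "open {z. h w / 2 < h z}"
    using h by (intro open_Collect_less continuous_intros)
  then have "open ({z. h w / 2 < h z} \<inter> ball 0 1)"
    by (intro open_Int) auto
  then obtain e where e: "0 < e" "ball w e \<subseteq> {z. h w / 2 < h z} \<inter> ball 0 1"
    using w by (auto elim!: openE[where x = w])
  have "0 < h w / 2 * measure lborel (ball w e)"
    using e w by (simp add: content_ball_pos)
  also have "\<dots> = (LINT z:ball w e|lborel. h w / 2)"
    by (simp add: set_lebesgue_integral_def)
  also have "\<dots> \<le> ball_integral h"
    unfolding ball_integral_def set_lebesgue_integral_def
  proof (rule integral_mono)
    show "integrable lborel (\<lambda>z. indicat_real (ball w e) z *\<^sub>R (h w / 2))"
      by (intro integrable_scaleR_left integrable_real_indicator) (use emeasure_lborel_ball_finite[of w e] in simp_all)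
    show "integrable lborel (\<lambda>z. indicat_real (cball 0 1) z *\<^sub>R h z)"
      using ball_integrable[OF h(1)] by (simp add: set_integrable_def)
    show "indicat_real (ball w e) z *\<^sub>R (h w / 2) \<le> indicat_real (cball 0 1) z *\<^sub>R h z" for z
      using e(2) h(2)[of z] by (force simp: indicator_def)
  qed
  finally show ?thesis .
qed

section \<open>Symmetries of the unit ball\<close>

lemma ball_integral_invariant:
  fixes T :: "'a::euclidean_space \<Rightarrow> 'a"
  assumes T: "distr lborel borel T = lborel" and cT: "continuous_on UNIV T"
    and norm: "\<And>z. norm (T z) = norm z" and h: "continuous_on UNIV h"
  shows "ball_integral (\<lambda>z. h (T z)) = ball_integral h"
proof -
  have H: "(\<lambda>z. indicat_real (cball 0 1) z * h z) \<in> borel_measurable borel"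
    using h by (intro borel_measurable_times borel_measurable_indicator borel_measurable_continuous_onI) auto
  have "ball_integral h = (\<integral>z. indicat_real (cball 0 1) z * h z \<partial>distr lborel borel T)"
    by (simp add: ball_integral_def set_lebesgue_integral_def T)
  also have "\<dots> = (\<integral>z. indicat_real (cball 0 1) (T z) * h (T z) \<partial>lborel)"
    using borel_measurable_continuous_onI[OF cT] by (intro integral_distr H) simp
  also have "\<dots> = ball_integral (\<lambda>z. h (T z))"
    by (simp add: ball_integral_def set_lebesgue_integral_def indicator_def norm)
  finally show ?thesis ..
qed

lemma ball_integral_reflect:
  fixes h :: "'a::euclidean_space \<Rightarrow> real" and c :: "'a \<Rightarrow> real"
  assumes c: "\<And>b. b \<in> Basis \<Longrightarrow> \<bar>c b\<bar> = 1" and h: "continuous_on UNIV h"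
  shows "ball_integral (\<lambda>z. h (\<Sum>b\<in>Basis. (c b * (z \<bullet> b)) *\<^sub>R b)) = ball_integral h"
proof (rule ball_integral_invariant[OF _ _ _ h])
  let ?T = "\<lambda>z. \<Sum>b\<in>Basis. (c b * (z \<bullet> b)) *\<^sub>R b"
  have "c b \<noteq> 0" if "b \<in> Basis" for b
    using c[OF that] by auto
  \<comment> \<open>The Jacobian factor is the product of the numbers
    \<open>\<bar>c b\<bar>\<close>, which is 1.\<close>
  from lborel_affine_euclidean[of c 0, OF this] show "distr lborel borel ?T = lborel"
    using c by (simp add: density_1)
  show "continuous_on UNIV ?T"
    by (intro continuous_intros)
  show "norm (?T z) = norm z" for z
  proof -
    have "?T z \<bullet> ?T z = (\<Sum>b\<in>Basis. (?T z \<bullet> b) * (?T z \<bullet> b))"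
      by (rule euclidean_inner)
    also have "\<dots> = (\<Sum>b\<in>Basis. (z \<bullet> b) * (z \<bullet> b))"
    proof (rule sum.cong)
      fix b :: 'a assume b: "b \<in> Basis"
      have "c b * c b = 1"
        using c[OF b] by (metis abs_mult_self_eq mult_1)
      then show "(?T z \<bullet> b) * (?T z \<bullet> b) = (z \<bullet> b) * (z \<bullet> b)"
        using b by (simp add: inner_sum_left_Basis algebra_simps)
    qed simp
    also have "\<dots> = z \<bullet> z"
      by (rule euclidean_inner[symmetric])
    finally show ?thesis
      by (simp add: norm_eq_sqrt_inner)
  qed
qed

lemma ball_integral_odd:
  fixes h :: "'a::euclidean_space \<Rightarrow> real"
  assumes "continuous_on UNIV h" "\<And>z. h (- z) = - h z"
  shows "ball_integral h = 0"
proof -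
  have "(\<Sum>b\<in>Basis. (- 1 * (z \<bullet> b)) *\<^sub>R b) = - z" for z :: 'a
    by (simp add: sum_negf euclidean_representation)
  then have "ball_integral h = ball_integral (\<lambda>z. - 1 * h z)"
    using ball_integral_reflect[of "\<lambda>_. - 1" h] assms by simp
  then show ?thesis
    unfolding ball_integral_cmult by simp
qed

text \<open>Flipping the sign of coordinate \<open>i\<close> alone preserves the ball and negates
  the integrand.\<close>

lemma ball_integral_coord_prod:
  fixes i j :: "'n::finite"
  assumes "i \<noteq> j"
  shows "ball_integral (\<lambda>z::real^'n. z $ i * z $ j) = 0"
proof -
  define c where "c b = (if b = axis i (1::real) then - 1 else 1 :: real)" for b :: "real^'n"
  define T where "T z = (\<Sum>b\<in>Basis. (c b * (z \<bullet> b)) *\<^sub>R b)" for z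
  have T: "T z $ k = c (axis k 1) * z $ k" for z k
    unfolding T_def cart_eq_inner_axis
    by (simp add: inner_sum_left_Basis axis_in_Basis_iff)
  have "ball_integral (\<lambda>z. T z $ i * T z $ j) = ball_integral (\<lambda>z. z $ i * z $ j)"
    unfolding T_def by (rule ball_integral_reflect) (auto simp: c_def intro!: continuous_intros)
  also have "(\<lambda>z. T z $ i * T z $ j) = (\<lambda>z. - 1 * (z $ i * z $ j))"
    using assms by (auto simp: T c_def axis_eq_axis)
  finally show ?thesis
    unfolding ball_integral_cmult by simp
qed

text \<open>The swap of coordinates \<open>i\<close> and \<open>j\<close> preserves norm and
  Lebesgue measure. The latter is checked on boxes, whose side lengths are merely permuted.\<close>

lemma ball_integral_coord_sq:
  fixes i j :: "'n::finite"
  shows "ball_integral (\<lambda>z::real^'n. z $ i * z $ i) = ball_integral (\<lambda>z. z $ j * z $ j)"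
proof -
  let ?p = "Transposition.transpose i j"
  define T where "T z = (\<chi> k. z $ ?p k)" for z :: "real^'n"
  have TT: "T (T z) = z" for z
    by (simp add: T_def vec_eq_iff)
  have T_axis: "T (axis k 1) = axis (?p k) 1" for k
    by (auto simp: T_def vec_eq_iff axis_def)
  then have T_Basis: "T b \<in> Basis" if "b \<in> Basis" for b
    using that by (auto simp: Basis_vec_def)
  have bij: "bij_betw T Basis Basis"
    using TT T_Basis by (intro bij_betw_byWitness[where f' = T]) auto
  have sum_p: "(\<Sum>k\<in>UNIV. g (?p k)) = (\<Sum>k\<in>UNIV. g k)" for g :: "'n \<Rightarrow> real"
    by (rule sum.reindex_bij_betw) simp
  have inner: "T v \<bullet> w = v \<bullet> T w" for v w
    using sum_p[of "\<lambda>k. v $ k * w $ ?p k"] by (simp add: T_def inner_vec_def)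
  have cT: "continuous_on UNIV T"
    unfolding T_def by (intro continuous_intros)
  \<comment> \<open>\<open>T\<close> is a self-adjoint involution permuting the basis, so it
    permutes the inequalities that define a box.\<close>
  have vimage: "T -` box l u = box (T l) (T u)" for l u
    unfolding set_eq_iff vimage_eq mem_box inner using T_Basis TT by metis
  have "distr lborel borel T = lborel"
  proof (rule lborel_eqI[symmetric])
    fix l u :: "real^'n" assume le: "\<And>b. b \<in> Basis \<Longrightarrow> l \<bullet> b \<le> u \<bullet> b"
    have "emeasure (distr lborel borel T) (box l u) = emeasure lborel (box (T l) (T u))"
      using borel_measurable_continuous_onI[OF cT] by (simp add: emeasure_distr vimage)
    also have "\<dots> = (\<Prod>b\<in>Basis. (T u - T l) \<bullet> b)"
      using le[OF T_Basis] by (simp add: emeasure_lborel_box_eq inner)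
    also have "(\<Prod>b\<in>Basis. (T u - T l) \<bullet> b) = (\<Prod>b\<in>Basis. (u - l) \<bullet> T b)"
      by (simp add: inner inner_diff_left)
    also have "\<dots> = (\<Prod>b\<in>Basis. (u - l) \<bullet> b)"
      by (rule prod.reindex_bij_betw[OF bij])
    finally show "emeasure (distr lborel borel T) (box l u) = (\<Prod>b\<in>Basis. (u - l) \<bullet> b)" .
  qed simp
  moreover have "norm (T z) = norm z" for z
    by (simp add: norm_eq_sqrt_inner inner TT)
  ultimately have "ball_integral (\<lambda>z. T z $ j * T z $ j) = ball_integral (\<lambda>z. z $ j * z $ j)"
    by (intro ball_integral_invariant[where h = "\<lambda>z. z $ j * z $ j"] cT continuous_intros)
  then show ?thesis
    by (simp add: T_def)
qed

section \<open>From the conditioned measure to integrals over the unit ball\<close>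

lemma ball_integral_affine:
  fixes h :: "'a::euclidean_space \<Rightarrow> real"
  assumes h: "continuous_on UNIV h" and \<epsilon>: "0 < \<epsilon>"
  shows "(LINT X:cball x \<epsilon>|lborel. h X) = \<epsilon> ^ DIM('a) * ball_integral (\<lambda>z. h (x + \<epsilon> *\<^sub>R z))"
proof -
  let ?T = "\<lambda>z. x + \<epsilon> *\<^sub>R z"
  let ?H = "\<lambda>X. indicat_real (cball x \<epsilon>) X * h X"
  have [measurable]: "h \<in> borel_measurable borel"
    using h by (rule borel_measurable_continuous_onI)
  have [measurable]: "?H \<in> borel_measurable borel"
    by (intro borel_measurable_times borel_measurable_indicator) auto
  have ind: "indicat_real (cball x \<epsilon>) (?T z) = indicat_real (cball 0 1) z" for z
    using \<epsilon> by (simp add: indicator_def dist_norm)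
  have "integral\<^sup>L lborel ?H = integral\<^sup>L (density (distr lborel borel ?T) (\<lambda>_. \<bar>\<epsilon>\<bar> ^ DIM('a))) ?H"
    using lborel_affine[of \<epsilon> x] \<epsilon> by simp
  also have "\<dots> = (\<integral>X. \<epsilon> ^ DIM('a) *\<^sub>R ?H X \<partial>distr lborel borel ?T)"
    using \<epsilon> by (subst integral_density) (auto simp: ennreal_power[symmetric] ennreal_indicator)
  also have "\<dots> = (\<integral>z. \<epsilon> ^ DIM('a) *\<^sub>R ?H (?T z) \<partial>lborel)"
    by (subst integral_distr) auto
  finally show ?thesis
    unfolding ind by (simp add: set_lebesgue_integral_def ball_integral_def)
qed

lemma uniform_measure_density:
  fixes f :: "'a::euclidean_space \<Rightarrow> real"
  assumes f: "continuous_on UNIV f" "\<And>x. 0 \<le> f x" and S: "compact S"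
    and c: "0 < (LINT X:S|lborel. f X)" (is "0 < ?c")
  shows "uniform_measure (density lborel (\<lambda>x. ennreal (f x))) S =
    density lborel (\<lambda>X. ennreal (indicator S X * f X / ?c))"
proof -
  have [measurable]: "f \<in> borel_measurable borel"
    using f(1) by (rule borel_measurable_continuous_onI)
  have [measurable]: "S \<in> sets borel"
    using S by (simp add: compact_imp_closed)
  have int: "integrable lborel (\<lambda>X. indicator S X * f X)"
    using set_integrable_compact_lborel[OF S continuous_on_subset[OF f(1) subset_UNIV]]
    by (simp add: set_integrable_def)
  have "emeasure (density lborel (\<lambda>x. ennreal (f x))) S = (\<integral>\<^sup>+X. ennreal (indicator S X * f X) \<partial>lborel)"
    by (subst emeasure_density) (auto intro!: nn_integral_cong simp: indicator_def)
  also have "\<dots> = ennreal ?c"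
    using f by (subst nn_integral_eq_integral[OF int]) (auto simp: set_lebesgue_integral_def)
  finally have em: "emeasure (density lborel (\<lambda>x. ennreal (f x))) S = ennreal ?c" .
  show ?thesis
    unfolding uniform_measure_def em
  proof (subst density_density_eq)
    show "density lborel (\<lambda>x. ennreal (f x) * (indicator S x / ennreal ?c)) =
        density lborel (\<lambda>X. ennreal (indicator S X * f X / ?c))"
    proof (rule density_cong)
      show "AE x in lborel. ennreal (f x) * (indicator S x / ennreal ?c) =
          ennreal (indicator S x * f x / ?c)"
        using f c by (intro AE_I2) (auto simp: indicator_def divide_ennreal[symmetric] ennreal_times_divide)
    qed measurable
  qed measurable
qed

text \<open>The vector-valued codomain covers the mean, and the separate integrability claim lets
  coordinates be taken under the integral.\<close>

lemma integral_uniform_measure_density: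
  fixes f :: "'a::euclidean_space \<Rightarrow> real" and h :: "'a \<Rightarrow> 'b::euclidean_space"
  assumes f: "continuous_on UNIV f" "\<And>x. 0 \<le> f x" and S: "compact S"
    and c: "0 < (LINT X:S|lborel. f X)" (is "0 < ?c") and h: "continuous_on UNIV h"
  shows "integrable (uniform_measure (density lborel (\<lambda>x. ennreal (f x))) S) h"
    and "(LINT X|uniform_measure (density lborel (\<lambda>x. ennreal (f x))) S. h X) =
      (1 / ?c) *\<^sub>R (LINT X:S|lborel. f X *\<^sub>R h X)"
proof -
  have [measurable]: "f \<in> borel_measurable borel" "h \<in> borel_measurable borel"
    using f(1) h by (auto intro: borel_measurable_continuous_onI)
  have [measurable]: "S \<in> sets borel"
    using S by (simp add: compact_imp_closed)
  have "set_integrable lborel S (\<lambda>X. f X *\<^sub>R h X)"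
    using f h by (intro set_integrable_compact_lborel S continuous_on_scaleR) (auto intro: continuous_on_subset)
  then have "integrable lborel (\<lambda>X. (1 / ?c) *\<^sub>R (indicator S X *\<^sub>R (f X *\<^sub>R h X)))"
    unfolding set_integrable_def by (rule integrable_scaleR_right)
  then have int: "integrable lborel (\<lambda>X. (indicator S X * f X / ?c) *\<^sub>R h X)"
    by simp
  show "integrable (uniform_measure (density lborel (\<lambda>x. ennreal (f x))) S) h"
    unfolding uniform_measure_density[OF f S c]
    using int f c by (subst integrable_density) auto
  have "(LINT X|uniform_measure (density lborel (\<lambda>x. ennreal (f x))) S. h X) =
      (\<integral>X. (indicator S X * f X / ?c) *\<^sub>R h X \<partial>lborel)"
    unfolding uniform_measure_density[OF f S c]
    using f c by (subst integral_density) auto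
  also have "\<dots> = (\<integral>X. (1 / ?c) *\<^sub>R (indicator S X *\<^sub>R (f X *\<^sub>R h X)) \<partial>lborel)"
    by simp
  also have "\<dots> = (1 / ?c) *\<^sub>R (LINT X:S|lborel. f X *\<^sub>R h X)"
    unfolding set_lebesgue_integral_def by (rule integral_scaleR_right)
  finally show "(LINT X|uniform_measure (density lborel (\<lambda>x. ennreal (f x))) S. h X) =
      (1 / ?c) *\<^sub>R (LINT X:S|lborel. f X *\<^sub>R h X)" .
qed

text \<open>In the variable \<open>X = x + \<epsilon> *\<^sub>R z\<close> the covariance is second
  moment minus product of means. The shift by \<open>x\<close> drops out, each of the two factors
  contributes one \<open>\<epsilon>\<close>, and the volume factor cancels against the
  normalisation.\<close>

lemma local_cov_density:
  fixes f :: "real^'m \<Rightarrow> real" and x :: "real^'m"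
  assumes f: "continuous_on UNIV f" "\<And>x. 0 \<le> f x" and \<epsilon>: "0 < \<epsilon>"
  defines "N \<equiv> \<lambda>g. ball_integral (\<lambda>z. g z * f (x + \<epsilon> *\<^sub>R z))"
  assumes N: "0 < N (\<lambda>_. 1)"
  shows "local_cov (density lborel (\<lambda>x. ennreal (f x))) \<epsilon> x $ i $ j =
    \<epsilon>\<^sup>2 * (N (\<lambda>z. z $ i * z $ j) / N (\<lambda>_. 1) - N (\<lambda>z. z $ i) / N (\<lambda>_. 1) * (N (\<lambda>z. z $ j) / N (\<lambda>_. 1)))"
proof -
  let ?c = "LINT X:cball x \<epsilon>|lborel. f X"
  let ?\<mu> = "uniform_measure (density lborel (\<lambda>x. ennreal (f x))) (cball x \<epsilon>)"
  let ?A = "N (\<lambda>_. 1)"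
  define u where "u k = N (\<lambda>z. z $ k) / ?A" for k
  have c: "?c = \<epsilon> ^ DIM(real^'m) * ?A"
    unfolding N_def using ball_integral_affine[OF f(1) \<epsilon>, of x] by simp
  have c0: "0 < ?c"
    unfolding c using N \<epsilon> by simp
  have cf: "continuous_on UNIV (\<lambda>z. f (x + \<epsilon> *\<^sub>R z))"
    by (rule continuous_on_compose2[OF f(1)]) (auto intro!: continuous_intros)
  have E: "(LINT X|?\<mu>. h X) = N (\<lambda>z. h (x + \<epsilon> *\<^sub>R z)) / ?A" if h: "continuous_on UNIV h" for h :: "real^'m \<Rightarrow> real"
  proof -
    have "(LINT X|?\<mu>. h X) = (1 / ?c) *\<^sub>R (LINT X:cball x \<epsilon>|lborel. f X *\<^sub>R h X)"
      by (rule integral_uniform_measure_density(2)[OF f compact_cball c0 h])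
    also have "(LINT X:cball x \<epsilon>|lborel. f X *\<^sub>R h X) = \<epsilon> ^ DIM(real^'m) * N (\<lambda>z. h (x + \<epsilon> *\<^sub>R z))"
      unfolding N_def using f(1) h by (subst ball_integral_affine[OF _ \<epsilon>])
        (auto intro!: continuous_intros simp: mult.commute)
    finally show ?thesis
      unfolding c using \<epsilon> by simp
  qed
  have N_lin: "N (\<lambda>z. a * g z + b * h z) = a * N g + b * N h"
    if "continuous_on UNIV g" "continuous_on UNIV h" for a b g h
    unfolding N_def using that cf
    by (simp add: distrib_right mult.assoc ball_integral_add ball_integral_cmult continuous_intros)
  have mean: "mean ?\<mu> $ k = x $ k + \<epsilon> * u k" for k
  proof -
    have "mean ?\<mu> $ k = (LINT X|?\<mu>. X $ k)"
      unfolding mean_def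
      by (rule integral_bounded_linear[OF bounded_linear_vec_nth
            integral_uniform_measure_density(1)[OF f compact_cball c0 continuous_on_id], symmetric])
    also have "\<dots> = N (\<lambda>z. (x $ k) * 1 + \<epsilon> * z $ k) / ?A"
      by (subst E) (auto intro!: continuous_intros)
    also have "N (\<lambda>z. (x $ k) * 1 + \<epsilon> * z $ k) = (x $ k) * ?A + \<epsilon> * N (\<lambda>z. z $ k)"
      by (rule N_lin) (auto intro!: continuous_intros)
    finally show ?thesis
      using N by (simp add: u_def add_divide_distrib)
  qed
  have "local_cov (density lborel (\<lambda>x. ennreal (f x))) \<epsilon> x $ i $ j =
      (LINT X|?\<mu>. (X $ i - mean ?\<mu> $ i) * (X $ j - mean ?\<mu> $ j))"
    by (simp add: local_cov_def cov_matrix_def)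
  also have "\<dots> = N (\<lambda>z. (\<epsilon> * z $ i - \<epsilon> * u i) * (\<epsilon> * z $ j - \<epsilon> * u j)) / ?A"
    by (subst E) (auto intro!: continuous_intros simp: mean)
  \<comment> \<open>Grouped as nested two-term combinations with explicit coefficients, the form to
    which \<open>N_lin\<close> applies.\<close>
  also have "(\<lambda>z. (\<epsilon> * z $ i - \<epsilon> * u i) * (\<epsilon> * z $ j - \<epsilon> * u j)) =
      (\<lambda>z. 1 * (\<epsilon>\<^sup>2 * (z $ i * z $ j) + (- \<epsilon>\<^sup>2 * u j) * z $ i) +
        1 * ((- \<epsilon>\<^sup>2 * u i) * z $ j + (\<epsilon>\<^sup>2 * u i * u j) * 1))"
    by (intro ext) (simp add: power2_eq_square algebra_simps)
  also have "N \<dots> = 1 * (\<epsilon>\<^sup>2 * N (\<lambda>z. z $ i * z $ j) + (- \<epsilon>\<^sup>2 * u j) * N (\<lambda>z. z $ i)) +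
        1 * ((- \<epsilon>\<^sup>2 * u i) * N (\<lambda>z. z $ j) + (\<epsilon>\<^sup>2 * u i * u j) * N (\<lambda>_. 1))"
    by (subst N_lin, (intro continuous_intros)+, subst N_lin, (intro continuous_intros)+,
        subst N_lin, (intro continuous_intros)+, rule refl)
  also have "\<dots> / ?A = \<epsilon>\<^sup>2 * (N (\<lambda>z. z $ i * z $ j) / ?A - u i * u j)"
    using N by (simp add: u_def field_simps)
  finally show ?thesis
    by (simp add: u_def)
qed

section \<open>Expansion of local moments\<close>

text \<open>Continuity here and in the next lemmas is in the direction, at a fixed base point; it
  makes the Taylor terms integrable in \<open>z\<close>.\<close>

lemma continuous_on_dir_deriv:
  assumes "smooth f" "continuous_on S u"
  shows "continuous_on S (\<lambda>z. dir_deriv (u z) f x)"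
  using assms(2) by (subst dir_deriv_basis[OF assms(1)]) (intro continuous_intros)

lemma continuous_on_dir_deriv2:
  assumes "smooth f" "continuous_on S u" "continuous_on S v"
  shows "continuous_on S (\<lambda>z. dir_deriv (v z) (dir_deriv (u z) f) x)"
proof -
  have "dir_deriv (v z) (dir_deriv (u z) f) x =
      (\<Sum>b\<in>Basis. (u z \<bullet> b) * dir_deriv (v z) (dir_deriv b f) x)" for z
    by (simp add: dir_deriv_basis[OF assms(1), of "u z"] dir_deriv_sum smooth_dir_deriv assms)
  then show ?thesis
    using assms by (auto intro!: continuous_intros continuous_on_dir_deriv smooth_dir_deriv)
qed

lemma continuous_on_dir_deriv3:
  assumes "smooth f" "continuous_on S u" "continuous_on S v" "continuous_on S w"
  shows "continuous_on S (\<lambda>z. dir_deriv (w z) (dir_deriv (v z) (dir_deriv (u z) f)) x)"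
proof -
  have "dir_deriv (w z) (dir_deriv (v z) (dir_deriv (u z) f)) x =
      (\<Sum>b\<in>Basis. (u z \<bullet> b) * dir_deriv (w z) (dir_deriv (v z) (dir_deriv b f)) x)" for z
    by (simp add: dir_deriv_basis[OF assms(1), of "u z"] dir_deriv_sum smooth_dir_deriv assms)
  then show ?thesis
    using assms by (auto intro!: continuous_intros continuous_on_dir_deriv2 smooth_dir_deriv)
qed

lemma continuous_on_iterated_dir_deriv:
  assumes "smooth f" "continuous_on S w"
  shows "continuous_on S (\<lambda>z. (dir_deriv (w z) ^^ n) f x)"
  using assms(1)
proof (induction n arbitrary: f)
  case (Suc n)
  have "(dir_deriv (w z) ^^ Suc n) f x = (\<Sum>b\<in>Basis. (w z \<bullet> b) * (dir_deriv (w z) ^^ n) (dir_deriv b f) x)" for z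
    unfolding funpow_Suc_right o_def
    by (subst dir_deriv_basis[OF Suc.prems], subst iterated_dir_deriv_sum)
      (auto intro: smooth_dir_deriv Suc.prems)
  then show ?case
    using Suc assms(2) by (auto intro!: continuous_intros smooth_dir_deriv simp del: funpow.simps)
qed simp

text \<open>The weighted mass of the ball centred at \<open>x + \<epsilon> *\<^sub>R y\<close>, up
  to the volume factor. Displacement and radius both scale with \<open>\<epsilon>\<close>, so the
  Taylor direction is \<open>y + z\<close>.\<close>

definition moment :: "('a::euclidean_space \<Rightarrow> real) \<Rightarrow> 'a \<Rightarrow> ('a \<Rightarrow> real) \<Rightarrow> 'a \<Rightarrow> real \<Rightarrow> real" where
  "moment f x g y \<epsilon> = ball_integral (\<lambda>z. g z * f (x + \<epsilon> *\<^sub>R (y + z)))"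

definition moment_coeff :: "('a::euclidean_space \<Rightarrow> real) \<Rightarrow> 'a \<Rightarrow> ('a \<Rightarrow> real) \<Rightarrow> nat \<Rightarrow> 'a \<Rightarrow> real" where
  "moment_coeff f x g k y = ball_integral (\<lambda>z. g z * ((dir_deriv (y + z) ^^ k) f x / fact k))"

text \<open>Every direction \<open>y + z\<close> with \<open>z\<close> in the unit ball has norm at
  most \<open>norm y + 1\<close>, so the Taylor error is uniform in \<open>z\<close> and survives
  integration.\<close>

lemma moment_expansion:
  fixes f :: "'a::euclidean_space \<Rightarrow> real"
  assumes f: "smooth f" and g: "continuous_on UNIV g"
  shows "\<exists>K. \<forall>\<epsilon>. 0 < \<epsilon> \<longrightarrow> \<epsilon> \<le> 1 \<longrightarrow>
    \<bar>moment f x g y \<epsilon> - (\<Sum>k<n. \<epsilon> ^ k * moment_coeff f x g k y)\<bar> \<le> K * \<epsilon> ^ n"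
proof -
  let ?T = "\<lambda>k z. (dir_deriv (y + z) ^^ k) f x / fact k"
  obtain K where K: "\<forall>w \<epsilon>. norm w \<le> norm y + 1 \<longrightarrow> 0 \<le> \<epsilon> \<longrightarrow> \<epsilon> \<le> 1 \<longrightarrow>
      \<bar>f (x + \<epsilon> *\<^sub>R w) - (\<Sum>k<n. \<epsilon> ^ k * ((dir_deriv w ^^ k) f x / fact k))\<bar> \<le> K * \<epsilon> ^ n"
    using smooth_taylor[OF f, of "norm y + 1" x n] by (rule exE)
  have "bounded (g ` cball 0 1)"
    using g by (intro compact_imp_bounded compact_continuous_image) (auto intro: continuous_on_subset)
  then obtain G where "\<forall>z\<in>cball 0 1. \<bar>g z\<bar> \<le> G"
    by (auto simp: bounded_iff)
  then have G: "\<bar>g z\<bar> \<le> G" if "norm z \<le> 1" for z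
    using that by simp
  have cT: "continuous_on UNIV (\<lambda>z. g z * ?T k z)" for k
    using f g by (intro continuous_intros continuous_on_iterated_dir_deriv) auto
  have "\<bar>moment f x g y \<epsilon> - (\<Sum>k<n. \<epsilon> ^ k * moment_coeff f x g k y)\<bar> \<le>
      (G * K * ball_integral (\<lambda>_::'a. 1)) * \<epsilon> ^ n" if \<epsilon>: "0 < \<epsilon>" "\<epsilon> \<le> 1" for \<epsilon>
  proof -
    have cf: "continuous_on UNIV (\<lambda>z. g z * f (x + \<epsilon> *\<^sub>R (y + z)))"
      using g by (intro continuous_on_mult continuous_on_compose2[OF smooth_continuous_on[OF f, of UNIV]])
        (auto intro!: continuous_intros)
    have cs: "continuous_on UNIV (\<lambda>z. \<Sum>k<n. \<epsilon> ^ k * (g z * ?T k z))"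
      by (intro continuous_on_sum continuous_on_mult_left cT)
    have "ball_integral (\<lambda>z. \<Sum>k<n. \<epsilon> ^ k * (g z * ?T k z)) =
        (\<Sum>k<n. ball_integral (\<lambda>z. \<epsilon> ^ k * (g z * ?T k z)))"
      by (rule ball_integral_sum) (auto intro: continuous_on_mult_left[OF cT] simp del: times_divide_eq_right)
    also have "\<dots> = (\<Sum>k<n. \<epsilon> ^ k * moment_coeff f x g k y)"
      unfolding ball_integral_cmult moment_coeff_def ..
    finally have "(\<Sum>k<n. \<epsilon> ^ k * moment_coeff f x g k y) =
        ball_integral (\<lambda>z. \<Sum>k<n. \<epsilon> ^ k * (g z * ?T k z))" ..
    then have "moment f x g y \<epsilon> - (\<Sum>k<n. \<epsilon> ^ k * moment_coeff f x g k y) =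
        ball_integral (\<lambda>z. g z * f (x + \<epsilon> *\<^sub>R (y + z)) - (\<Sum>k<n. \<epsilon> ^ k * (g z * ?T k z)))"
      unfolding moment_def by (simp only: ball_integral_diff[OF cf cs])
    also have "\<bar>\<dots>\<bar> \<le> G * (K * \<epsilon> ^ n) * ball_integral (\<lambda>_::'a. 1)"
    proof (rule ball_integral_bound)
      show "continuous_on UNIV (\<lambda>z. g z * f (x + \<epsilon> *\<^sub>R (y + z)) - (\<Sum>k<n. \<epsilon> ^ k * (g z * ?T k z)))"
        by (intro continuous_on_diff cf cs)
      fix z :: 'a assume z: "norm z \<le> 1"
      have "g z * f (x + \<epsilon> *\<^sub>R (y + z)) - (\<Sum>k<n. \<epsilon> ^ k * (g z * ?T k z)) =
          g z * (f (x + \<epsilon> *\<^sub>R (y + z)) - (\<Sum>k<n. \<epsilon> ^ k * ?T k z))"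
        by (simp add: right_diff_distrib sum_distrib_left mult.left_commute)
      also have "\<bar>\<dots>\<bar> \<le> G * (K * \<epsilon> ^ n)"
        unfolding abs_mult using G[OF z] z \<epsilon> norm_triangle_ineq[of y z]
        by (intro mult_mono K[rule_format]) auto
      finally show "\<bar>g z * f (x + \<epsilon> *\<^sub>R (y + z)) - (\<Sum>k<n. \<epsilon> ^ k * (g z * ?T k z))\<bar> \<le> G * (K * \<epsilon> ^ n)" .
    qed
    finally show ?thesis
      by (simp add: mult_ac)
  qed
  then show ?thesis by blast
qed

lemma moment_limit:
  assumes "smooth f" "continuous_on UNIV g" "\<And>k. k < n \<Longrightarrow> moment_coeff f x g k y = 0"
  shows "((\<lambda>\<epsilon>. moment f x g y \<epsilon> / \<epsilon> ^ n) \<longlongrightarrow> moment_coeff f x g n y) (at_right 0)"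
proof -
  obtain K where "\<And>\<epsilon>. 0 < \<epsilon> \<Longrightarrow> \<epsilon> \<le> 1 \<Longrightarrow>
    \<bar>moment f x g y \<epsilon> - (\<Sum>k<Suc n. \<epsilon> ^ k * moment_coeff f x g k y)\<bar> \<le> K * \<epsilon> ^ Suc n"
    using moment_expansion[OF assms(1,2)] by metis
  then show ?thesis
    by (rule expansion_leading_term) (use assms(3) in auto)
qed

text \<open>Subtracting the expansions at displacements \<open>y\<close> and \<open>0\<close>
  cancels the lower orders on which they agree.\<close>

lemma moment_diff_limit:
  assumes "smooth f" "continuous_on UNIV g"
    and eq: "\<And>k. k < n \<Longrightarrow> moment_coeff f x g k y = moment_coeff f x g k 0"
  shows "((\<lambda>\<epsilon>. (moment f x g y \<epsilon> - moment f x g 0 \<epsilon>) / \<epsilon> ^ n) \<longlongrightarrow>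
    moment_coeff f x g n y - moment_coeff f x g n 0) (at_right 0)"
proof -
  obtain K1 where K1: "\<And>\<epsilon>. 0 < \<epsilon> \<Longrightarrow> \<epsilon> \<le> 1 \<Longrightarrow>
    \<bar>moment f x g y \<epsilon> - (\<Sum>k<Suc n. \<epsilon> ^ k * moment_coeff f x g k y)\<bar> \<le> K1 * \<epsilon> ^ Suc n"
    using moment_expansion[OF assms(1,2)] by metis
  obtain K0 where K0: "\<And>\<epsilon>. 0 < \<epsilon> \<Longrightarrow> \<epsilon> \<le> 1 \<Longrightarrow>
    \<bar>moment f x g 0 \<epsilon> - (\<Sum>k<Suc n. \<epsilon> ^ k * moment_coeff f x g k 0)\<bar> \<le> K0 * \<epsilon> ^ Suc n"
    using moment_expansion[OF assms(1,2)] by metis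
  let ?c = "\<lambda>k. moment_coeff f x g k y - moment_coeff f x g k 0"
  have "\<bar>moment f x g y \<epsilon> - moment f x g 0 \<epsilon> - (\<Sum>k<Suc n. \<epsilon> ^ k * ?c k)\<bar> \<le> (K1 + K0) * \<epsilon> ^ Suc n"
    if "0 < \<epsilon>" "\<epsilon> \<le> 1" for \<epsilon>
    using K1[OF that] K0[OF that] unfolding right_diff_distrib sum_subtractf distrib_right by linarith
  then show ?thesis
    by (rule expansion_leading_term) (use eq in auto)
qed

section \<open>Dependence of the moment coefficients on the displacement\<close>

context
  fixes f :: "real^'m \<Rightarrow> real" and x :: "real^'m"
  assumes f: "smooth f"
begin

abbreviation (input) "D1 u \<equiv> dir_deriv u f x"
abbreviation (input) "D2 u v \<equiv> dir_deriv v (dir_deriv u f) x"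
abbreviation (input) "D3 u v w \<equiv> dir_deriv w (dir_deriv v (dir_deriv u f)) x"

lemmas D_cont = continuous_on_dir_deriv[OF f] continuous_on_dir_deriv2[OF f]
  continuous_on_dir_deriv3[OF f]

lemmas D_linear = smooth_multilinear dir_deriv_add dir_deriv_cmult dir_deriv_minus
  smooth_dir_deriv smooth_add f

lemma D_minus:
  "D1 (- u) = - D1 u" "D2 (- u) v = - D2 u v" "D2 u (- v) = - D2 u v"
  "D3 (- u) v w = - D3 u v w" "D3 u (- v) w = - D3 u v w" "D3 u v (- w) = - D3 u v w"
  by (simp_all add: D_linear)

lemma moment_coeff_0: "moment_coeff f x g 0 y = f x * ball_integral g"
  unfolding moment_coeff_def by (simp add: mult.commute[of _ "f x"] ball_integral_cmult)

lemma moment_coeff_1: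
  assumes g: "continuous_on UNIV g"
  shows "moment_coeff f x g 1 y = D1 y * ball_integral g + ball_integral (\<lambda>z. g z * D1 z)"
proof -
  have "moment_coeff f x g 1 y = ball_integral (\<lambda>z. D1 y * g z + g z * D1 z)"
    unfolding moment_coeff_def by (simp add: D_linear algebra_simps)
  also have "\<dots> = D1 y * ball_integral g + ball_integral (\<lambda>z. g z * D1 z)"
    using g by (subst ball_integral_add) (auto intro!: continuous_intros D_cont simp: ball_integral_cmult)
  finally show ?thesis .
qed

text \<open>Expanding bilinearly in \<open>y + z\<close>, the term in \<open>z\<close> alone cancels
  in the difference and the term in \<open>y\<close> alone leaves the integral. The mixed terms
  occur in both orders.\<close>

lemma moment_coeff_2:
  assumes g: "continuous_on UNIV g"
  shows "moment_coeff f x g 2 y - moment_coeff f x g 2 0 =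
    (1/2) * (D2 y y * ball_integral g + ball_integral (\<lambda>z. g z * (D2 y z + D2 z y)))"
proof -
  have "moment_coeff f x g 2 y - moment_coeff f x g 2 0 =
      ball_integral (\<lambda>z. g z * (D2 (y + z) (y + z) / 2) - g z * (D2 (0 + z) (0 + z) / 2))"
    unfolding moment_coeff_def numeral_2_eq_2 using g
    by (subst ball_integral_diff[symmetric]) (auto intro!: continuous_intros D_cont)
  also have "\<dots> = ball_integral (\<lambda>z. (1/2) * (D2 y y * g z + g z * (D2 y z + D2 z y)))"
    by (rule arg_cong[where f = ball_integral]) (auto simp: D_linear field_simps)
  also have "\<dots> = (1/2) * (D2 y y * ball_integral g + ball_integral (\<lambda>z. g z * (D2 y z + D2 z y)))"
    unfolding ball_integral_cmult using g
    by (subst ball_integral_add) (auto intro!: continuous_intros D_cont simp: ball_integral_cmult)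
  finally show ?thesis .
qed

lemma moment_coeff_3:
  assumes g: "continuous_on UNIV g"
  shows "moment_coeff f x g 3 y - moment_coeff f x g 3 0 =
    (1/6) * (D3 y y y * ball_integral g + ball_integral (\<lambda>z. g z * (D3 y y z + D3 y z y + D3 z y y))
      + ball_integral (\<lambda>z. g z * (D3 y z z + D3 z y z + D3 z z y)))"
proof -
  have "moment_coeff f x g 3 y - moment_coeff f x g 3 0 =
      ball_integral (\<lambda>z. g z * (D3 (y + z) (y + z) (y + z) / 6) - g z * (D3 (0 + z) (0 + z) (0 + z) / 6))"
    unfolding moment_coeff_def numeral_3_eq_3 using g
    by (subst ball_integral_diff[symmetric]) (auto intro!: continuous_intros D_cont simp: fact_numeral)
  also have "\<dots> = ball_integral (\<lambda>z. (1/6) * (D3 y y y * g z + g z * (D3 y y z + D3 y z y + D3 z y y)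
      + g z * (D3 y z z + D3 z y z + D3 z z y)))"
    by (rule arg_cong[where f = ball_integral]) (auto simp: D_linear field_simps)
  also have "\<dots> = (1/6) * (D3 y y y * ball_integral g
      + ball_integral (\<lambda>z. g z * (D3 y y z + D3 y z y + D3 z y y))
      + ball_integral (\<lambda>z. g z * (D3 y z z + D3 z y z + D3 z z y)))"
    unfolding ball_integral_cmult using g
    by (subst ball_integral_add ball_integral_add[of "\<lambda>z. D3 y y y * g z"],
        (auto intro!: continuous_intros D_cont simp: ball_integral_cmult)[2])+
      (simp add: ball_integral_cmult)
  finally show ?thesis .
qed

text \<open>Terms in \<open>y\<close> alone carry the factor \<open>ball_integral g\<close>, which
  is zero. At order 2 only mixed terms remain, with a single \<open>y\<close>, hence
  linearity.\<close>

lemma odd_moment: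
  assumes g: "continuous_on UNIV g" and odd: "\<And>z. g (- z) = - g z"
  shows "moment_coeff f x g 0 y = 0" "moment_coeff f x g 1 y = moment_coeff f x g 1 0"
    "linear (\<lambda>y. moment_coeff f x g 2 y - moment_coeff f x g 2 0)"
proof -
  have g0: "ball_integral g = 0"
    by (rule ball_integral_odd[OF g odd])
  show "moment_coeff f x g 0 y = 0" "moment_coeff f x g 1 y = moment_coeff f x g 1 0"
    unfolding moment_coeff_0 moment_coeff_1[OF g] by (simp_all add: g0)
  have "(\<lambda>y. moment_coeff f x g 2 y - moment_coeff f x g 2 0) =
      (\<lambda>y. ball_integral (\<lambda>z. (1/2) * (g z * (D2 y z + D2 z y))))"
    by (simp only: moment_coeff_2[OF g] g0 ball_integral_cmult mult_zero_right add_0)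
  moreover have "linear (\<lambda>y. ball_integral (\<lambda>z. (1/2) * (g z * (D2 y z + D2 z y))))"
  proof (rule linearI)
    fix u v :: "real^'m"
    have "ball_integral (\<lambda>z. (1/2) * (g z * (D2 (u + v) z + D2 z (u + v)))) =
        ball_integral (\<lambda>z. (1/2) * (g z * (D2 u z + D2 z u)) + (1/2) * (g z * (D2 v z + D2 z v)))"
      by (rule arg_cong[where f = ball_integral]) (auto simp: D_linear algebra_simps)
    also have "\<dots> = ball_integral (\<lambda>z. (1/2) * (g z * (D2 u z + D2 z u))) +
        ball_integral (\<lambda>z. (1/2) * (g z * (D2 v z + D2 z v)))"
      using g by (intro ball_integral_add continuous_intros D_cont)
    finally show "ball_integral (\<lambda>z. (1/2) * (g z * (D2 (u + v) z + D2 z (u + v)))) = \<dots>" .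
  next
    fix c and u :: "real^'m"
    have "ball_integral (\<lambda>z. (1/2) * (g z * (D2 (c *\<^sub>R u) z + D2 z (c *\<^sub>R u)))) =
        ball_integral (\<lambda>z. c * ((1/2) * (g z * (D2 u z + D2 z u))))"
      by (rule arg_cong[where f = ball_integral]) (auto simp: D_linear algebra_simps)
    then show "ball_integral (\<lambda>z. (1/2) * (g z * (D2 (c *\<^sub>R u) z + D2 z (c *\<^sub>R u)))) =
        c *\<^sub>R ball_integral (\<lambda>z. (1/2) * (g z * (D2 u z + D2 z u)))"
      by (simp only: ball_integral_cmult real_scaleR_def)
  qed
  ultimately show "linear (\<lambda>y. moment_coeff f x g 2 y - moment_coeff f x g 2 0)"
    by simp
qed

text \<open>Terms in \<open>y\<close> alone vanish by \<open>g0\<close>, and terms with one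
  \<open>z\<close> integrate to zero by parity. The first dependence on \<open>y\<close> thus comes
  at order 3, from terms with one \<open>y\<close> and two copies of \<open>z\<close>.\<close>

lemma even_moment:
  assumes g: "continuous_on UNIV g" and even: "\<And>z. g (- z) = g z" and g0: "ball_integral g = 0"
  shows "moment_coeff f x g 0 y = 0" "moment_coeff f x g 1 y = 0"
    "moment_coeff f x g 2 y = moment_coeff f x g 2 0"
    "linear (\<lambda>y. moment_coeff f x g 3 y - moment_coeff f x g 3 0)"
proof -
  show "moment_coeff f x g 0 y = 0"
    by (simp add: moment_coeff_0 g0)
  have "ball_integral (\<lambda>z. g z * D1 z) = 0"
    using g by (intro ball_integral_odd continuous_intros D_cont) (auto simp: even D_minus)
  then show "moment_coeff f x g 1 y = 0"
    by (simp add: moment_coeff_1[OF g] g0 del: One_nat_def)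
  have "ball_integral (\<lambda>z. g z * (D2 y z + D2 z y)) = 0"
    using g by (intro ball_integral_odd continuous_intros D_cont) (auto simp: even D_minus algebra_simps)
  then show "moment_coeff f x g 2 y = moment_coeff f x g 2 0"
    using moment_coeff_2[OF g, of y] by (simp add: g0)
  have "ball_integral (\<lambda>z. g z * (D3 y y z + D3 y z y + D3 z y y)) = 0" for y
    using g by (intro ball_integral_odd continuous_intros D_cont) (auto simp: even D_minus algebra_simps)
  then have "(\<lambda>y. moment_coeff f x g 3 y - moment_coeff f x g 3 0) =
      (\<lambda>y. ball_integral (\<lambda>z. (1/6) * (g z * (D3 y z z + D3 z y z + D3 z z y))))"
    by (simp only: moment_coeff_3[OF g] g0 ball_integral_cmult mult_zero_right add_0)
  moreover have "linear (\<lambda>y. ball_integral (\<lambda>z. (1/6) * (g z * (D3 y z z + D3 z y z + D3 z z y))))"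
  proof (rule linearI)
    fix u v :: "real^'m"
    have "ball_integral (\<lambda>z. (1/6) * (g z * (D3 (u + v) z z + D3 z (u + v) z + D3 z z (u + v)))) =
        ball_integral (\<lambda>z. (1/6) * (g z * (D3 u z z + D3 z u z + D3 z z u)) +
          (1/6) * (g z * (D3 v z z + D3 z v z + D3 z z v)))"
      by (rule arg_cong[where f = ball_integral]) (auto simp: D_linear algebra_simps)
    also have "\<dots> = ball_integral (\<lambda>z. (1/6) * (g z * (D3 u z z + D3 z u z + D3 z z u))) +
        ball_integral (\<lambda>z. (1/6) * (g z * (D3 v z z + D3 z v z + D3 z z v)))"
      using g by (intro ball_integral_add continuous_intros D_cont)
    finally show "ball_integral (\<lambda>z. (1/6) * (g z * (D3 (u + v) z z + D3 z (u + v) z + D3 z z (u + v)))) = \<dots>" .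
  next
    fix c and u :: "real^'m"
    have "ball_integral (\<lambda>z. (1/6) * (g z * (D3 (c *\<^sub>R u) z z + D3 z (c *\<^sub>R u) z + D3 z z (c *\<^sub>R u)))) =
        ball_integral (\<lambda>z. c * ((1/6) * (g z * (D3 u z z + D3 z u z + D3 z z u))))"
      by (rule arg_cong[where f = ball_integral]) (auto simp: D_linear algebra_simps)
    then show "ball_integral (\<lambda>z. (1/6) * (g z * (D3 (c *\<^sub>R u) z z + D3 z (c *\<^sub>R u) z + D3 z z (c *\<^sub>R u)))) =
        c *\<^sub>R ball_integral (\<lambda>z. (1/6) * (g z * (D3 u z z + D3 z u z + D3 z z u)))"
      by (simp only: ball_integral_cmult real_scaleR_def)
  qed
  ultimately show "linear (\<lambda>y. moment_coeff f x g 3 y - moment_coeff f x g 3 0)"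
    by simp
qed

end

section \<open>The limiting quadratic form\<close>

lemma tendsto_divide_power_lower:
  fixes h :: "real \<Rightarrow> real"
  assumes "((\<lambda>\<epsilon>. h \<epsilon> / \<epsilon> ^ k) \<longlongrightarrow> l) (at_right 0)" "0 < k"
  shows "(h \<longlongrightarrow> 0) (at_right 0)"
proof -
  have "((\<lambda>\<epsilon>. h \<epsilon> / \<epsilon> ^ k * \<epsilon> ^ k) \<longlongrightarrow> l * 0 ^ k) (at_right 0)"
    by (intro tendsto_intros assms)
  moreover have "\<forall>\<^sub>F \<epsilon> in at_right 0. h \<epsilon> / \<epsilon> ^ k * \<epsilon> ^ k = h \<epsilon>"
    using eventually_at_right_less[of "0::real"] by eventually_elim simp
  ultimately have "(h \<longlongrightarrow> l * 0 ^ k) (at_right 0)"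
    by (rule Lim_transform_eventually)
  then show ?thesis
    using assms(2) by (simp add: zero_power)
qed

text \<open>Rests on \<open>p / a - p' / a' = (p - p') / a - p' * (a - a') / (a * a')\<close>; the
  power \<open>Suc k\<close> splits as \<open>k\<close> for \<open>p'\<close> and one for
  \<open>a - a'\<close>.\<close>

lemma quotient_diff_limit:
  fixes p p' a a' :: "real \<Rightarrow> real"
  assumes p: "((\<lambda>\<epsilon>. p' \<epsilon> / \<epsilon> ^ k) \<longlongrightarrow> \<beta>) (at_right 0)"
    and dp: "((\<lambda>\<epsilon>. (p \<epsilon> - p' \<epsilon>) / \<epsilon> ^ Suc k) \<longlongrightarrow> B) (at_right 0)"
    and a: "(a \<longlongrightarrow> c) (at_right 0)" "(a' \<longlongrightarrow> c) (at_right 0)" "c \<noteq> 0"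
    and da: "((\<lambda>\<epsilon>. (a \<epsilon> - a' \<epsilon>) / \<epsilon>) \<longlongrightarrow> A) (at_right 0)"
  shows "((\<lambda>\<epsilon>. (p \<epsilon> / a \<epsilon> - p' \<epsilon> / a' \<epsilon>) / \<epsilon> ^ Suc k) \<longlongrightarrow> B / c - \<beta> * A / (c * c)) (at_right 0)"
proof -
  have "((\<lambda>\<epsilon>. (p \<epsilon> - p' \<epsilon>) / \<epsilon> ^ Suc k / a \<epsilon> -
      p' \<epsilon> / \<epsilon> ^ k * ((a \<epsilon> - a' \<epsilon>) / \<epsilon>) / (a \<epsilon> * a' \<epsilon>)) \<longlongrightarrow> B / c - \<beta> * A / (c * c)) (at_right 0)"
    using a by (intro tendsto_intros assms) auto
  moreover have "\<forall>\<^sub>F \<epsilon> in at_right 0. (p \<epsilon> - p' \<epsilon>) / \<epsilon> ^ Suc k / a \<epsilon> -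
      p' \<epsilon> / \<epsilon> ^ k * ((a \<epsilon> - a' \<epsilon>) / \<epsilon>) / (a \<epsilon> * a' \<epsilon>) = (p \<epsilon> / a \<epsilon> - p' \<epsilon> / a' \<epsilon>) / \<epsilon> ^ Suc k"
    using eventually_at_right_less[of "0::real"] tendsto_imp_eventually_ne[OF a(1,3)]
      tendsto_imp_eventually_ne[OF a(2,3)]
    by eventually_elim (simp add: field_simps)
  ultimately show ?thesis
    by (rule Lim_transform_eventually)
qed

lemma tendsto_matrix:
  fixes A :: "'b \<Rightarrow> real^'n^'m"
  assumes "\<And>i j. ((\<lambda>x. A x $ i $ j) \<longlongrightarrow> L $ i $ j) F"
  shows "(A \<longlongrightarrow> L) F"
  using assms by (intro vec_tendstoI)

lemma linear_matrix:
  fixes L :: "'a::real_vector \<Rightarrow> real^'n^'m"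
  assumes "\<And>i j. linear (\<lambda>y. L y $ i $ j)"
  shows "linear L"
proof (rule linearI)
  show "L (u + v) = L u + L v" for u v
    using linear_add[OF assms] by (simp add: vec_eq_iff)
  show "L (c *\<^sub>R u) = c *\<^sub>R L u" for c u
    using linear_scale[OF assms] by (simp add: vec_eq_iff)
qed

text \<open>The even functions \<open>z\<^sub>i z\<^sub>j - r \<delta>\<^sub>i\<^sub>j\<close> have mean zero over the unit ball when
  \<open>r\<close> is its coordinate variance.  Subtracting \<open>r \<delta>\<^sub>i\<^sub>j\<close> removes the dominant part of the
  covariance, so that the dependence on \<open>y\<close> shows up only at relative order \<open>\<epsilon>\<^sup>3\<close>, linearly.\<close>

lemma local_cov_expansion:
  fixes f :: "real^'m \<Rightarrow> real" and x :: "real^'m"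
  assumes f: "smooth f" and nonneg: "\<And>x. 0 \<le> f x" and fx: "f x \<noteq> 0"
  defines "\<alpha> \<equiv> density lborel (\<lambda>x. ennreal (f x))"
  shows "\<exists>r (L :: real^'m \<Rightarrow> real^'m^'m). 0 < r \<and> linear L \<and>
    ((\<lambda>\<epsilon>. (1 / \<epsilon>\<^sup>2) *\<^sub>R local_cov \<alpha> \<epsilon> x) \<longlongrightarrow> r *\<^sub>R mat 1) (at_right 0) \<and>
    (\<forall>y. ((\<lambda>\<epsilon>. (1 / \<epsilon> ^ 5) *\<^sub>R (local_cov \<alpha> \<epsilon> (x + \<epsilon> *\<^sub>R y) - local_cov \<alpha> \<epsilon> x)) \<longlongrightarrow> L y) (at_right 0))"
proof -
  \<comment> \<open>An arbitrary coordinate: \<open>ball_integral_coord_sq\<close> makes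
    \<open>r\<close> independent of the choice.\<close>
  define k0 :: 'm where "k0 = undefined"
  define V where "V = ball_integral (\<lambda>_::real^'m. 1)"
  define r where "r = ball_integral (\<lambda>z::real^'m. z $ k0 * z $ k0) / V"
  define m where "m = moment f x"
  define g where "g i j z = z $ i * z $ j - (if i = j then r else 0)" for i j and z :: "real^'m"
  let ?one = "\<lambda>_::real^'m. 1::real"
  have V: "0 < V"
    unfolding V_def by (rule ball_integral_pos[where w = 0]) auto
  have "0 < ball_integral (\<lambda>z::real^'m. z $ k0 * z $ k0)"
    by (rule ball_integral_pos[where w = "(1/2) *\<^sub>R axis k0 1"])
      (auto intro!: continuous_intros simp: norm_axis_1)
  then have r: "0 < r"
    using V by (simp add: r_def)
  have cg: "continuous_on UNIV (g i j)" for i j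
    unfolding g_def by (intro continuous_intros)
  have const: "ball_integral (\<lambda>_::real^'m. a) = a * V" for a
    using ball_integral_cmult[of a ?one] by (simp add: V_def)
  have g0: "ball_integral (g i j) = 0" for i j
  proof -
    have "ball_integral (g i j) = ball_integral (\<lambda>z. z $ i * z $ j) - (if i = j then r else 0) * V"
      unfolding g_def by (subst ball_integral_diff) (auto intro!: continuous_intros simp: const)
    then show ?thesis
      using V ball_integral_coord_prod[of i j] ball_integral_coord_sq[of i k0] by (auto simp: r_def)
  qed
  have ck: "continuous_on UNIV (\<lambda>z::real^'m. z $ i)" for i
    by (intro continuous_intros)
  note odd = odd_moment[OF f ck vector_uminus_component]
  have gm: "g i j (- z) = g i j z" for i j z
    by (simp add: g_def)
  note even = even_moment[OF f cg gm g0]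

  \<comment> \<open>Leading coefficients: \<open>c\<close> and \<open>A\<close> for the mass and its
    increment in \<open>y\<close>, \<open>\<beta>\<close> and \<open>B\<close> for the first
    moments, \<open>\<eta>\<close> and \<open>E\<close> for the moments of \<open>g\<close>.\<close>
  define c where "c = f x * V"
  have c: "c \<noteq> 0" "0 < c"
    using V fx nonneg[of x] by (auto simp: c_def less_le)
  define A where "A y = dir_deriv y f x * V" for y
  define \<beta> where "\<beta> i = moment_coeff f x (\<lambda>z. z $ i) 1 0" for i
  define B where "B i y = moment_coeff f x (\<lambda>z. z $ i) 2 y - moment_coeff f x (\<lambda>z. z $ i) 2 0" for i y
  define \<eta> where "\<eta> i j = moment_coeff f x (g i j) 2 0" for i j
  define E where "E i j y = moment_coeff f x (g i j) 3 y - moment_coeff f x (g i j) 3 0" for i j y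
  have a: "(m ?one y \<longlongrightarrow> c) (at_right 0)" for y
    using moment_limit[OF f, of ?one 0 x y] unfolding moment_coeff_0[OF f]
    by (simp add: m_def c_def V_def)
  have da: "((\<lambda>\<epsilon>. (m ?one y \<epsilon> - m ?one 0 \<epsilon>) / \<epsilon>) \<longlongrightarrow> A y) (at_right 0)" for y
    using moment_diff_limit[OF f, of ?one 1 x y] linear_0[OF linear_dir_deriv[OF f]]
    unfolding less_one moment_coeff_1[OF f continuous_on_const]
    by (simp add: moment_coeff_0[OF f] m_def A_def V_def)
  have b: "((\<lambda>\<epsilon>. m (\<lambda>z. z $ i) y \<epsilon> / \<epsilon> ^ 1) \<longlongrightarrow> \<beta> i) (at_right 0)" for i y
    unfolding m_def \<beta>_def odd(2)[where y = y, symmetric]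
    by (rule moment_limit[OF f ck]) (metis less_one odd(1))
  have db: "((\<lambda>\<epsilon>. (m (\<lambda>z. z $ i) y \<epsilon> - m (\<lambda>z. z $ i) 0 \<epsilon>) / \<epsilon> ^ Suc 1) \<longlongrightarrow> B i y) (at_right 0)" for i y
    unfolding m_def B_def Suc_1
    by (rule moment_diff_limit[OF f ck]) (metis less_2_cases odd(1,2) One_nat_def)
  have e: "((\<lambda>\<epsilon>. m (g i j) y \<epsilon> / \<epsilon> ^ 2) \<longlongrightarrow> \<eta> i j) (at_right 0)" for i j y
    unfolding m_def \<eta>_def even(3)[where y = y, symmetric]
    by (rule moment_limit[OF f cg]) (metis less_2_cases even(1,2) One_nat_def)
  have eq3: "moment_coeff f x (g i j) k y = moment_coeff f x (g i j) k 0" if "k < 3" for i j k y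
  proof -
    from that have "k = 0 \<or> k = 1 \<or> k = 2" by auto
    then show ?thesis
      by (elim disjE) (simp_all only: even(1,2) even(3)[where y = y])
  qed
  have de: "((\<lambda>\<epsilon>. (m (g i j) y \<epsilon> - m (g i j) 0 \<epsilon>) / \<epsilon> ^ Suc 2) \<longlongrightarrow> E i j y) (at_right 0)" for i j y
    using moment_diff_limit[OF f cg eq3] unfolding m_def E_def by simp

  define u where "u i y \<epsilon> = m (\<lambda>z. z $ i) y \<epsilon> / m ?one y \<epsilon>" for i y \<epsilon>
  define v where "v i j y \<epsilon> = m (g i j) y \<epsilon> / m ?one y \<epsilon>" for i j y \<epsilon>
  \<comment> \<open>The covariance entry divided by the squared radius. Normalising by the mass
    turns the \<open>r\<close> subtracted in \<open>g\<close> into a constant, which drops out of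
    increments in \<open>y\<close>.\<close>
  define S where "S i j y \<epsilon> = (if i = j then r else 0) + v i j y \<epsilon> - u i y \<epsilon> * u j y \<epsilon>" for i j y \<epsilon>
  define U where "U i y = B i y / c - \<beta> i * A y / (c * c)" for i y
  define L where "L y = (\<chi> i j. E i j y / c - \<eta> i j * A y / (c * c)
      - (U i y * (\<beta> j / c) + \<beta> i / c * U j y))" for y
  have u: "((\<lambda>\<epsilon>. u i y \<epsilon> / \<epsilon>) \<longlongrightarrow> \<beta> i / c) (at_right 0)" for i y
  proof -
    have "((\<lambda>\<epsilon>. m (\<lambda>z. z $ i) y \<epsilon> / \<epsilon> ^ 1 / m ?one y \<epsilon>) \<longlongrightarrow> \<beta> i / c) (at_right 0)"
      by (intro tendsto_intros a b c)
    then show ?thesis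
      by (simp add: u_def mult.commute)
  qed
  have du: "((\<lambda>\<epsilon>. (u i y \<epsilon> - u i 0 \<epsilon>) / \<epsilon>\<^sup>2) \<longlongrightarrow> U i y) (at_right 0)" for i y
    using quotient_diff_limit[OF b db a a c(1) da] by (simp add: u_def U_def numeral_2_eq_2)
  have dv: "((\<lambda>\<epsilon>. (v i j y \<epsilon> - v i j 0 \<epsilon>) / \<epsilon> ^ 3) \<longlongrightarrow> E i j y / c - \<eta> i j * A y / (c * c)) (at_right 0)" for i j y
    using quotient_diff_limit[OF e de a a c(1) da] by (simp add: v_def numeral_3_eq_3 numeral_2_eq_2)
  have dS: "((\<lambda>\<epsilon>. (S i j y \<epsilon> - S i j 0 \<epsilon>) / \<epsilon> ^ 3) \<longlongrightarrow> L y $ i $ j) (at_right 0)" for i j y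
  proof -
    \<comment> \<open>Product rule for \<open>u i * u j\<close>: an increment of order 2 times a
      factor of order 1 matches the order 3 of the increment of \<open>v\<close>.\<close>
    have "((\<lambda>\<epsilon>. (v i j y \<epsilon> - v i j 0 \<epsilon>) / \<epsilon> ^ 3 - ((u i y \<epsilon> - u i 0 \<epsilon>) / \<epsilon>\<^sup>2 * (u j y \<epsilon> / \<epsilon>)
        + u i 0 \<epsilon> / \<epsilon> * ((u j y \<epsilon> - u j 0 \<epsilon>) / \<epsilon>\<^sup>2))) \<longlongrightarrow> L y $ i $ j) (at_right 0)"
      unfolding L_def vec_lambda_beta by (intro tendsto_intros u du dv)
    moreover have "\<forall>\<^sub>F \<epsilon> in at_right 0. (v i j y \<epsilon> - v i j 0 \<epsilon>) / \<epsilon> ^ 3 -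
        ((u i y \<epsilon> - u i 0 \<epsilon>) / \<epsilon>\<^sup>2 * (u j y \<epsilon> / \<epsilon>) + u i 0 \<epsilon> / \<epsilon> * ((u j y \<epsilon> - u j 0 \<epsilon>) / \<epsilon>\<^sup>2))
        = (S i j y \<epsilon> - S i j 0 \<epsilon>) / \<epsilon> ^ 3"
      using eventually_at_right_less[of "0::real"]
      by eventually_elim (simp add: S_def field_simps power2_eq_square power3_eq_cube)
    ultimately show ?thesis
      by (rule Lim_transform_eventually)
  qed
  have S: "(S i j 0 \<longlongrightarrow> (if i = j then r else 0)) (at_right 0)" for i j
  proof -
    have "(u i 0 \<longlongrightarrow> 0) (at_right 0)" for i
      using u[of i 0] by (intro tendsto_divide_power_lower[where k = 1]) simp_all
    moreover have "(v i j 0 \<longlongrightarrow> 0 / c) (at_right 0)"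
      unfolding v_def by (intro tendsto_divide tendsto_divide_power_lower[OF e] a c) simp
    ultimately have "((\<lambda>\<epsilon>. (if i = j then r else 0) + v i j 0 \<epsilon> - u i 0 \<epsilon> * u j 0 \<epsilon>) \<longlongrightarrow>
        (if i = j then r else 0) + 0 / c - 0 * 0) (at_right 0)"
      by (intro tendsto_intros)
    then show ?thesis
      by (simp add: S_def[abs_def])
  qed
  \<comment> \<open>The mass tends to \<open>c > 0\<close> and so is eventually positive, as
    \<open>local_cov_density\<close> requires at the displaced centre.\<close>
  have cov: "\<forall>\<^sub>F \<epsilon> in at_right 0. local_cov \<alpha> \<epsilon> (x + \<epsilon> *\<^sub>R y) $ i $ j = \<epsilon>\<^sup>2 * S i j y \<epsilon>" for i j y
    using eventually_at_right_less[of "0::real"] order_tendstoD(1)[OF a[of y] c(2)]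
  proof eventually_elim
    case (elim \<epsilon>)
    have m_eq: "ball_integral (\<lambda>z. h z * f (x + \<epsilon> *\<^sub>R y + \<epsilon> *\<^sub>R z)) = m h y \<epsilon>" for h
      by (simp add: m_def moment_def scaleR_add_right add.assoc)
    have cf: "continuous_on UNIV (\<lambda>z. f (x + \<epsilon> *\<^sub>R (y + z)))"
      by (rule continuous_on_compose2[OF smooth_continuous_on[OF f, of UNIV]]) (auto intro!: continuous_intros)
    have "m (g i j) y \<epsilon> = ball_integral (\<lambda>z. z $ i * z $ j * f (x + \<epsilon> *\<^sub>R (y + z))
        - (if i = j then r else 0) * (1 * f (x + \<epsilon> *\<^sub>R (y + z))))"
      by (simp add: m_def moment_def g_def left_diff_distrib)
    also have "\<dots> = m (\<lambda>z. z $ i * z $ j) y \<epsilon> - (if i = j then r else 0) * m ?one y \<epsilon>"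
      unfolding m_def moment_def ball_integral_cmult[symmetric]
      using cf by (intro ball_integral_diff continuous_intros)
    finally have "m (\<lambda>z. z $ i * z $ j) y \<epsilon> / m ?one y \<epsilon> = (if i = j then r else 0) + v i j y \<epsilon>"
      using elim by (simp add: v_def field_simps)
    then show ?case
      using local_cov_density[OF smooth_continuous_on[OF f] nonneg elim(1), of "x + \<epsilon> *\<^sub>R y" i j]
        elim(2) unfolding m_eq \<alpha>_def S_def u_def by simp
  qed
  have "linear (\<lambda>y. L y $ i $ j)" for i j
  proof -
    interpret A: linear A
      by (rule linearI) (simp_all add: A_def linear_add[OF linear_dir_deriv[OF f]]
          linear_scale[OF linear_dir_deriv[OF f]] algebra_simps)
    interpret B: linear "B i" for i
      unfolding B_def by (rule odd(3))
    interpret E: linear "E i j" for i j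
      unfolding E_def by (rule even(4))
    show ?thesis
      by (rule linearI) (simp_all add: L_def U_def A.add A.scale B.add B.scale E.add E.scale
          add_divide_distrib algebra_simps)
  qed
  then have "linear L"
    by (rule linear_matrix)
  moreover have "((\<lambda>\<epsilon>. (1 / \<epsilon>\<^sup>2) *\<^sub>R local_cov \<alpha> \<epsilon> x) \<longlongrightarrow> r *\<^sub>R mat 1) (at_right 0)"
  proof (rule tendsto_matrix)
    fix i j
    have "\<forall>\<^sub>F \<epsilon> in at_right 0. S i j 0 \<epsilon> = ((1 / \<epsilon>\<^sup>2) *\<^sub>R local_cov \<alpha> \<epsilon> x) $ i $ j"
      using cov[of 0 i j] eventually_at_right_less[of "0::real"] by eventually_elim simp
    with S[of i j] show "((\<lambda>\<epsilon>. ((1 / \<epsilon>\<^sup>2) *\<^sub>R local_cov \<alpha> \<epsilon> x) $ i $ j) \<longlongrightarrow> (r *\<^sub>R mat 1) $ i $ j) (at_right 0)"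
      by (auto simp: mat_def intro: Lim_transform_eventually)
  qed
  moreover have "((\<lambda>\<epsilon>. (1 / \<epsilon> ^ 5) *\<^sub>R (local_cov \<alpha> \<epsilon> (x + \<epsilon> *\<^sub>R y) - local_cov \<alpha> \<epsilon> x)) \<longlongrightarrow> L y) (at_right 0)" for y
  proof (rule tendsto_matrix)
    fix i j
    have "\<forall>\<^sub>F \<epsilon> in at_right 0. (S i j y \<epsilon> - S i j 0 \<epsilon>) / \<epsilon> ^ 3 =
        ((1 / \<epsilon> ^ 5) *\<^sub>R (local_cov \<alpha> \<epsilon> (x + \<epsilon> *\<^sub>R y) - local_cov \<alpha> \<epsilon> x)) $ i $ j"
      using cov[of 0 i j] cov[of y i j] eventually_at_right_less[of "0::real"]
    proof eventually_elim
      case (elim \<epsilon>)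
      have "(S i j y \<epsilon> - S i j 0 \<epsilon>) / \<epsilon> ^ 3 = (\<epsilon>\<^sup>2 * S i j y \<epsilon> - \<epsilon>\<^sup>2 * S i j 0 \<epsilon>) / \<epsilon> ^ 5"
        using elim(3) by (simp add: field_simps eval_nat_numeral)
      then show ?case
        using elim by simp
    qed
    with dS show "((\<lambda>\<epsilon>. ((1 / \<epsilon> ^ 5) *\<^sub>R (local_cov \<alpha> \<epsilon> (x + \<epsilon> *\<^sub>R y) - local_cov \<alpha> \<epsilon> x)) $ i $ j) \<longlongrightarrow>
        L y $ i $ j) (at_right 0)"
      by (rule Lim_transform_eventually)
  qed
  ultimately show ?thesis
    using r by blast
qed

lemma transpose_local_cov: "transpose (local_cov \<alpha> \<epsilon> x) = local_cov \<alpha> \<epsilon> x"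
  by (simp add: local_cov_def cov_matrix_def transpose_def mult.commute)

text \<open>Uses \<open>d_cov_asymptotics\<close> with \<open>s = r * \<epsilon>\<^sup>2\<close> and
  \<open>t = \<epsilon> ^ 3\<close>, so that \<open>s * t\<^sup>2\<close> is
  \<open>r * \<epsilon> ^ 8\<close>. The remaining factor \<open>1 / (4 * r)\<close> is absorbed
  into the linear map through \<open>1 / (2 * sqrt r)\<close>.\<close>

lemma d_cov_local_cov_limit:
  fixes f :: "real^'m \<Rightarrow> real" and x :: "real^'m"
  assumes "smooth f" "\<And>x. 0 \<le> f x" "f x \<noteq> 0"
  defines "\<alpha> \<equiv> density lborel (\<lambda>x. ennreal (f x))"
  shows "\<exists>L :: real^'m \<Rightarrow> real^'m^'m. linear L \<and>
    (\<forall>y. ((\<lambda>\<epsilon>. (d_cov (local_cov \<alpha> \<epsilon> x) (local_cov \<alpha> \<epsilon> (x + \<epsilon> *\<^sub>R y)))\<^sup>2 / \<epsilon> ^ 8) \<longlongrightarrow>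
      (norm (L y))\<^sup>2) (at_right 0))"
proof -
  obtain r L where r: "0 < r" and L: "linear (L :: real^'m \<Rightarrow> real^'m^'m)"
    and A: "((\<lambda>\<epsilon>. (1 / \<epsilon>\<^sup>2) *\<^sub>R local_cov \<alpha> \<epsilon> x) \<longlongrightarrow> r *\<^sub>R mat 1) (at_right 0)"
    and D: "\<forall>y. ((\<lambda>\<epsilon>. (1 / \<epsilon> ^ 5) *\<^sub>R (local_cov \<alpha> \<epsilon> (x + \<epsilon> *\<^sub>R y) - local_cov \<alpha> \<epsilon> x)) \<longlongrightarrow> L y) (at_right 0)"
    unfolding \<alpha>_def using local_cov_expansion[OF assms(1-3)] by blast
  have "((\<lambda>\<epsilon>. (d_cov (local_cov \<alpha> \<epsilon> x) (local_cov \<alpha> \<epsilon> (x + \<epsilon> *\<^sub>R y)))\<^sup>2 / \<epsilon> ^ 8) \<longlongrightarrow>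
      (norm ((1 / (2 * sqrt r)) *\<^sub>R L y))\<^sup>2) (at_right 0)" for y
  proof -
    define A' where "A' \<epsilon> = (1 / (r * \<epsilon>\<^sup>2)) *\<^sub>R local_cov \<alpha> \<epsilon> x" for \<epsilon>
    define B' where "B' \<epsilon> = (1 / (r * \<epsilon>\<^sup>2)) *\<^sub>R local_cov \<alpha> \<epsilon> (x + \<epsilon> *\<^sub>R y)" for \<epsilon>
    have pos: "\<forall>\<^sub>F \<epsilon> in at_right 0. 0 < (\<epsilon>::real)"
      by (rule eventually_at_right_less)
    have "((\<lambda>\<epsilon>. (1 / r) *\<^sub>R ((1 / \<epsilon>\<^sup>2) *\<^sub>R local_cov \<alpha> \<epsilon> x)) \<longlongrightarrow> (1 / r) *\<^sub>R (r *\<^sub>R mat 1)) (at_right 0)"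
      by (intro tendsto_intros A)
    then have A': "(A' \<longlongrightarrow> mat 1) (at_right 0)"
      using r by (simp add: A'_def[abs_def] mult.commute)
    have "((\<lambda>\<epsilon>. (1 / r) *\<^sub>R ((1 / \<epsilon> ^ 5) *\<^sub>R (local_cov \<alpha> \<epsilon> (x + \<epsilon> *\<^sub>R y) - local_cov \<alpha> \<epsilon> x))) \<longlongrightarrow>
        (1 / r) *\<^sub>R L y) (at_right 0)"
      by (intro tendsto_intros D[rule_format])
    also have "(\<lambda>\<epsilon>. (1 / r) *\<^sub>R ((1 / \<epsilon> ^ 5) *\<^sub>R (local_cov \<alpha> \<epsilon> (x + \<epsilon> *\<^sub>R y) - local_cov \<alpha> \<epsilon> x))) =
        (\<lambda>\<epsilon>. (1 / \<epsilon> ^ 3) *\<^sub>R (B' \<epsilon> - A' \<epsilon>))"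
    proof
      fix \<epsilon> :: real
      have "\<epsilon> ^ 5 = \<epsilon> ^ 3 * \<epsilon>\<^sup>2"
        by (simp add: power_add[symmetric])
      then show "(1 / r) *\<^sub>R ((1 / \<epsilon> ^ 5) *\<^sub>R (local_cov \<alpha> \<epsilon> (x + \<epsilon> *\<^sub>R y) - local_cov \<alpha> \<epsilon> x)) =
          (1 / \<epsilon> ^ 3) *\<^sub>R (B' \<epsilon> - A' \<epsilon>)"
        by (simp add: A'_def B'_def scaleR_diff_right[symmetric] mult_ac)
    qed
    finally have D': "((\<lambda>\<epsilon>. (1 / \<epsilon> ^ 3) *\<^sub>R (B' \<epsilon> - A' \<epsilon>)) \<longlongrightarrow> (1 / r) *\<^sub>R L y) (at_right 0)" .
    have "((\<lambda>\<epsilon>. (d_cov ((r * \<epsilon>\<^sup>2) *\<^sub>R A' \<epsilon>) ((r * \<epsilon>\<^sup>2) *\<^sub>R B' \<epsilon>))\<^sup>2 / (r * \<epsilon>\<^sup>2 * (\<epsilon> ^ 3)\<^sup>2)) \<longlongrightarrow>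
        (norm ((1 / r) *\<^sub>R L y))\<^sup>2 / 4) (at_right 0)"
    proof (rule d_cov_asymptotics[OF _ _ A' D'])
      show "transpose (A' \<epsilon>) = A' \<epsilon>" "transpose (B' \<epsilon>) = B' \<epsilon>" for \<epsilon>
        by (simp_all add: A'_def B'_def transpose_scalar transpose_local_cov)
      show "((\<lambda>\<epsilon>::real. \<epsilon> ^ 3) \<longlongrightarrow> 0) (at_right 0)"
        by (auto intro!: tendsto_eq_intros)
      show "\<forall>\<^sub>F \<epsilon> in at_right 0. 0 < (\<epsilon>::real) ^ 3" "\<forall>\<^sub>F \<epsilon> in at_right 0. 0 < r * (\<epsilon>::real)\<^sup>2"
        using pos r by (auto elim!: eventually_mono)
    qed
    then have "((\<lambda>\<epsilon>. r * ((d_cov ((r * \<epsilon>\<^sup>2) *\<^sub>R A' \<epsilon>) ((r * \<epsilon>\<^sup>2) *\<^sub>R B' \<epsilon>))\<^sup>2 / (r * \<epsilon>\<^sup>2 * (\<epsilon> ^ 3)\<^sup>2))) \<longlongrightarrow>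
        r * ((norm ((1 / r) *\<^sub>R L y))\<^sup>2 / 4)) (at_right 0)"
      by (rule tendsto_mult_left)
    moreover have "r * ((norm ((1 / r) *\<^sub>R L y))\<^sup>2 / 4) = (norm ((1 / (2 * sqrt r)) *\<^sub>R L y))\<^sup>2"
      using r by (simp add: power_mult_distrib power_divide field_simps power2_eq_square)
    moreover have "\<forall>\<^sub>F \<epsilon> in at_right 0.
        r * ((d_cov ((r * \<epsilon>\<^sup>2) *\<^sub>R A' \<epsilon>) ((r * \<epsilon>\<^sup>2) *\<^sub>R B' \<epsilon>))\<^sup>2 / (r * \<epsilon>\<^sup>2 * (\<epsilon> ^ 3)\<^sup>2)) =
        (d_cov (local_cov \<alpha> \<epsilon> x) (local_cov \<alpha> \<epsilon> (x + \<epsilon> *\<^sub>R y)))\<^sup>2 / \<epsilon> ^ 8"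
      using pos
    proof eventually_elim
      case (elim \<epsilon>)
      have "\<epsilon> ^ 8 = \<epsilon>\<^sup>2 * (\<epsilon> ^ 3)\<^sup>2"
        by (simp add: power_add[symmetric] power_mult[symmetric])
      then show ?case
        using elim r by (simp add: A'_def B'_def)
    qed
    ultimately show ?thesis
      by (auto intro: Lim_transform_eventually)
  qed
  moreover have "linear (\<lambda>y. (1 / (2 * sqrt r)) *\<^sub>R L y)"
    using L by (rule linear_compose_scale_right)
  ultimately show ?thesis
    by blast
qed

section \<open>From the quadratic form to the ellipsoid\<close>

text \<open>The matrix of the form is that of the identity plus \<open>adjoint L\<close> composed
  with \<open>L\<close>; the first summand makes it definite.\<close>

lemma ellipsoid_quadratic:
  fixes L :: "real^'m \<Rightarrow> 'b::euclidean_space"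
  assumes L: "linear L"
  shows "ellipsoid {x0 + y | y. (norm y)\<^sup>2 + (norm (L y))\<^sup>2 \<le> 1}"
proof -
  define T where "T y = y + adjoint L (L y)" for y
  define Q where "Q = matrix T"
  have lT: "linear T"
    unfolding T_def by (intro linear_compose_add linear_ident linear_compose[OF L, unfolded o_def] adjoint_linear L)
  have Q: "Q *v y = T y" for y
    unfolding Q_def using fun_cong[OF matrix_vector_mul(2)[OF lT]] .
  have sym: "y \<bullet> T w = T y \<bullet> w" for y w
    by (simp add: T_def inner_add_left inner_add_right adjoint_clauses[OF L])
  have quad: "y \<bullet> (Q *v y) = (norm y)\<^sup>2 + (norm (L y))\<^sup>2" for y
    by (simp add: Q T_def inner_add_right adjoint_works[OF L] power2_norm_eq_inner)
  have "adjoint T = T"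
    using sym by (intro adjoint_unique) simp
  then have "transpose Q = Q"
    unfolding Q_def by (metis matrix_adjoint[OF lT])
  then have "pos_def Q"
    unfolding pos_def_def quad by (auto simp: add_pos_nonneg)
  then show ?thesis
    unfolding ellipsoid_def by (intro exI[of _ x0] exI[of _ Q]) (simp add: quad)
qed

text \<open>Pointwise convergence decides membership wherever the limit form differs from 1. Points
  on the level set 1 are reached only by the closure.\<close>

lemma ellipsoid_closure_limsup:
  fixes L :: "real^'m \<Rightarrow> 'b::euclidean_space"
  assumes L: "linear L"
    and lim: "\<And>y. ((\<lambda>\<epsilon>. q \<epsilon> y) \<longlongrightarrow> (norm y)\<^sup>2 + (norm (L y))\<^sup>2) (at_right 0)"
    and S: "\<And>\<epsilon> y. 0 < \<epsilon> \<Longrightarrow> x0 + y \<in> S \<epsilon> \<longleftrightarrow> q \<epsilon> y \<le> (1::real)"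
  shows "ellipsoid (closure (limsup_set S))"
proof -
  let ?q = "\<lambda>y. (norm y)\<^sup>2 + (norm (L y))\<^sup>2"
  let ?E = "{x0 + y | y. ?q y \<le> 1}"
  have inner: "x0 + y \<in> limsup_set S" if "?q y < 1" for y
  proof -
    have "\<exists>\<epsilon>\<in>{0<..<\<delta>}. x0 + y \<in> S \<epsilon>" if "0 < \<delta>" for \<delta>
    proof -
      have "\<forall>\<^sub>F \<epsilon> in at_right 0. q \<epsilon> y < 1 \<and> \<epsilon> \<in> {0<..<\<delta>}"
        using order_tendstoD(2)[OF lim \<open>?q y < 1\<close>] eventually_at_right_real[OF that]
        by eventually_elim simp
      then obtain \<epsilon> where "q \<epsilon> y < 1" "\<epsilon> \<in> {0<..<\<delta>}"
        using eventually_happens'[OF trivial_limit_at_right_real] by blast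
      then show ?thesis
        using S by (intro bexI[of _ \<epsilon>]) auto
    qed
    then show ?thesis
      by (auto simp: limsup_set_def)
  qed
  have outer: "?q y \<le> 1" if "x0 + y \<in> limsup_set S" for y
  proof (rule ccontr)
    assume "\<not> ?q y \<le> 1"
    then have "\<forall>\<^sub>F \<epsilon> in at_right 0. 1 < q \<epsilon> y"
      using order_tendstoD(1)[OF lim] by simp
    then obtain \<delta> where "0 < \<delta>" "\<And>\<epsilon>. 0 < \<epsilon> \<Longrightarrow> \<epsilon> < \<delta> \<Longrightarrow> 1 < q \<epsilon> y"
      by (auto simp: eventually_at_right_field)
    moreover have "x0 + y \<in> (\<Union>\<epsilon>\<in>{0<..<\<delta>}. S \<epsilon>)"
      using that \<open>0 < \<delta>\<close> unfolding limsup_set_def by blast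
    then obtain \<epsilon> where "0 < \<epsilon>" "\<epsilon> < \<delta>" "x0 + y \<in> S \<epsilon>"
      by auto
    ultimately show False
      using S[of \<epsilon> y] by fastforce
  qed
  have cL: "continuous_on UNIV L"
    using L by (simp add: linear_continuous_on linear_linear)
  have "closed {y. ?q y \<le> 1}"
    by (intro closed_Collect_le continuous_intros cL)
  then have "closed ((+) x0 ` {y. ?q y \<le> 1})"
    by (rule closed_translation)
  also have "(+) x0 ` {y. ?q y \<le> 1} = ?E"
    by auto
  finally have "closed ?E" .
  moreover have "limsup_set S \<subseteq> ?E"
  proof
    fix x assume "x \<in> limsup_set S"
    with outer[of "x - x0"] show "x \<in> ?E"
      by (intro CollectI exI[of _ "x - x0"]) simp
  qed
  ultimately have "closure (limsup_set S) \<subseteq> ?E"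
    by (rule closure_minimal[rotated])
  moreover have "x0 + y \<in> closure (limsup_set S)" if y: "?q y \<le> 1" for y
  proof -
    \<comment> \<open>Shrinking \<open>y\<close> by these factors, which start at 0 and increase to
      1, moves a boundary point into the open sublevel set.\<close>
    define s where "s n = 1 - inverse (real (Suc n))" for n
    have s: "s \<longlonglongrightarrow> 1"
      unfolding s_def using tendsto_diff[OF tendsto_const LIMSEQ_inverse_real_of_nat, of 1] by simp
    have "x0 + s n *\<^sub>R y \<in> limsup_set S" for n
    proof (rule inner)
      have s1: "0 \<le> s n" "s n < 1"
        by (auto simp: s_def field_simps)
      have "?q (s n *\<^sub>R y) = (s n)\<^sup>2 * ?q y"
        by (simp add: linear_scale[OF L] power_mult_distrib distrib_left)
      also have "\<dots> \<le> (s n)\<^sup>2"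
        using y by (simp add: mult_left_le)
      also have "\<dots> < 1"
        using s1 by (simp add: power_less_one_iff abs_square_less_1)
      finally show "?q (s n *\<^sub>R y) < 1" .
    qed
    moreover have "(\<lambda>n. x0 + s n *\<^sub>R y) \<longlonglongrightarrow> x0 + 1 *\<^sub>R y"
      by (intro tendsto_intros s)
    ultimately show ?thesis
      unfolding closure_sequential by (intro exI[of _ "\<lambda>n. x0 + s n *\<^sub>R y"]) simp
  qed
  ultimately have "closure (limsup_set S) = ?E"
    by blast
  then show ?thesis
    using ellipsoid_quadratic[OF L] by simp
qed

lemma mem_rescale_gt_ball:
  assumes \<epsilon>: "0 < \<epsilon>"
  shows "x0 + y \<in> rescale x0 \<epsilon> (gt_ball \<alpha> \<epsilon> (\<epsilon> powi (-6)) x0) \<longleftrightarrow>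
    (norm y)\<^sup>2 + (d_cov (local_cov \<alpha> \<epsilon> x0) (local_cov \<alpha> \<epsilon> (x0 + \<epsilon> *\<^sub>R y)))\<^sup>2 / \<epsilon> ^ 8 \<le> 1"
proof -
  let ?d = "(d_cov (local_cov \<alpha> \<epsilon> x0) (local_cov \<alpha> \<epsilon> (x0 + \<epsilon> *\<^sub>R y)))\<^sup>2"
  have "x0 + y \<in> rescale x0 \<epsilon> T \<longleftrightarrow> x0 + \<epsilon> *\<^sub>R y \<in> T" for T
  proof
    assume "x0 + y \<in> rescale x0 \<epsilon> T"
    then show "x0 + \<epsilon> *\<^sub>R y \<in> T"
      using \<epsilon> by (auto simp: rescale_def)
  next
    assume "x0 + \<epsilon> *\<^sub>R y \<in> T"
    then show "x0 + y \<in> rescale x0 \<epsilon> T"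
      using \<epsilon> unfolding rescale_def by (intro image_eqI[of _ _ "x0 + \<epsilon> *\<^sub>R y"]) auto
  qed
  then have "x0 + y \<in> rescale x0 \<epsilon> (gt_ball \<alpha> \<epsilon> (\<epsilon> powi (-6)) x0) \<longleftrightarrow>
      sqrt ((\<epsilon> * norm y)\<^sup>2 + \<epsilon> powi (-6) * ?d) \<le> \<epsilon>"
    using \<epsilon> by (simp add: gt_ball_def gt_dist_def)
  \<comment> \<open>Squaring exposes a common factor \<open>\<epsilon>\<^sup>2\<close>; removing it
    turns the weight \<open>\<epsilon> powi (-6)\<close> into division by
    \<open>\<epsilon> ^ 8\<close>.\<close>
  also have "\<dots> \<longleftrightarrow> (\<epsilon> * norm y)\<^sup>2 + \<epsilon> powi (-6) * ?d \<le> \<epsilon>\<^sup>2 * 1"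
    using \<epsilon> real_sqrt_le_iff[of _ "\<epsilon>\<^sup>2"] by simp
  also have "(\<epsilon> * norm y)\<^sup>2 + \<epsilon> powi (-6) * ?d = \<epsilon>\<^sup>2 * ((norm y)\<^sup>2 + ?d / \<epsilon> ^ 8)"
  proof -
    have "\<epsilon> ^ 8 = \<epsilon>\<^sup>2 * \<epsilon> ^ 6"
      by (simp add: power_add[symmetric])
    then show ?thesis
      using \<epsilon> by (simp add: power_int_minus field_simps)
  qed
  also have "\<epsilon>\<^sup>2 * ((norm y)\<^sup>2 + ?d / \<epsilon> ^ 8) \<le> \<epsilon>\<^sup>2 * 1 \<longleftrightarrow> (norm y)\<^sup>2 + ?d / \<epsilon> ^ 8 \<le> 1"
    using \<epsilon> by (subst mult_le_cancel_left_pos) auto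
  finally show ?thesis .
qed

theorem theorem3p4:
  fixes \<alpha> :: "(real^'m) measure" and f :: "real^'m \<Rightarrow> real" and x0 :: "real^'m"
  assumes "prob_space \<alpha>"
    and "measure_support \<alpha> = UNIV"
    and "\<alpha> = density lborel (\<lambda>x. ennreal (f x))"
    and "smooth f"
    and "\<And>x. 0 \<le> f x"
    and "\<And>x. f x \<noteq> 0"
  shows "ellipsoid (closure (limsup_set
           (\<lambda>\<epsilon>. rescale x0 \<epsilon> (gt_ball \<alpha> \<epsilon> (\<epsilon> powi (-6)) x0))))"
proof -
  obtain L where L: "linear (L :: real^'m \<Rightarrow> real^'m^'m)"
    and lim: "\<forall>y. ((\<lambda>\<epsilon>. (d_cov (local_cov \<alpha> \<epsilon> x0) (local_cov \<alpha> \<epsilon> (x0 + \<epsilon> *\<^sub>R y)))\<^sup>2 / \<epsilon> ^ 8) \<longlongrightarrow>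
      (norm (L y))\<^sup>2) (at_right 0)"
    unfolding assms(3) using d_cov_local_cov_limit[OF assms(4,5,6)] by blast
  show ?thesis
    by (rule ellipsoid_closure_limsup[OF L tendsto_add[OF tendsto_const lim[rule_format]] mem_rescale_gt_ball])
qed

end
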